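(* Fix $\nu>0$, and suppose that $\varphi=\gamma*\eta$ for some Borel probability measure $\eta$ on $\mathbb{R}^d$ satisfying $$a_\eta=\inf_{\xi\in\mathbb{R}^d}|\widehat\eta(\xi)|>0 .$$ Then, for every $n\ge3$, $$R_n(\mathcal{M}_{\varphi,\nu})\gtrsim a_\eta^2\,\nu^d\,\frac{(\log n)^{d/2}}{n} .$$ Moreover, every such $\varphi$ belongs to $\mathcal{L}_2(\mathbb{R}^d)\cap\mathcal{L}_\infty(\mathbb{R}^d)\cap\mathcal{P}$ and there exist constants $c,C>0$ such that $|\widehat\varphi(\xi)|\le C\exp(-c\|\xi\|_2^2)$ for all $\xi\in\mathbb{R}^d$.
   Context: $\mathcal{P}$ is the set of all probability density functions on $\mathbb{R}^d$. $\gamma(x)=(2\pi)^{-d/2}\exp(-\|x\|_2^2/2)$ is the standard Gaussian density on $\mathbb{R}^d$, and $(\gamma*\eta)(x)=\int_{\mathbb{R}^d}\gamma(x-y)\,\eta(dy)$. Fourier transforms: $\widehat g(\xi)=(2\pi)^{-d/2}\int e^{-i\langle x,\xi\rangle}g(x)\,dx$ for functions and $\widehat\mu(\xi)=(2\pi)^{-d/2}\int e^{-i\langle x,\xi\rangle}\mu(dx)$ for finite signed measures. $\varphi_\nu(x)=\nu^d\varphi(\nu x)$. $\mathcal{M}_{\varphi,\nu}$ is the class of functions $x\mapsto\int_{\mathbb{R}^d}\varphi_\nu(x-\mu)\,G(d\mu)$, where $G$ ranges over all probability measures on $\mathbb{R}^d$. For a class $\mathcal{F}\subset\mathcal{L}_2\cap\mathcal{P}$,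 the squared $\mathcal{L}_2$ minimax risk is $$R_n(\mathcal{F})=\inf_{\tilde f_n}\sup_{f_0\in\mathcal{F}}\mathrm{E}_{f_0}\|\tilde f_n-f_0\|_2^2,$$ where $\tilde f_n$ ranges over all measurable estimators based on $n$ i.i.d. observations with density $f_0$, with the convention that the loss is infinite whenever $\tilde f_n$ is not $\mathcal{L}_2$-valued. $a\gtrsim b$ means $a\ge C'b$ for a constant $C'>0$ independent of the principal asymptotic variables (here, of $n$). *)

theory Defs
  imports "HOL-Probability.Probability"
begin

text \<open>Euclidean space of dimension d is a type \<open>'a\<close> of class \<^class>\<open>euclidean_space\<close>, with
  d = \<open>DIM('a)\<close>.\<close>

definition L2 :: "('a::euclidean_space \<Rightarrow> real) set" where
  "L2 = {f \<in> borel_measurable borel. integrable lborel (\<lambda>x. (f x)\<^sup>2)}"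

definition Linf :: "('a::euclidean_space \<Rightarrow> real) set" where
  "Linf = {f \<in> borel_measurable borel. \<exists>B. AE x in lborel. \<bar>f x\<bar> \<le> B}"

definition prob_densities :: "('a::euclidean_space \<Rightarrow> real) set" where
  "prob_densities =
     {f \<in> borel_measurable borel. (\<forall>x. 0 \<le> f x) \<and> (\<integral>\<^sup>+x. ennreal (f x) \<partial>lborel) = 1}"

definition borel_prob :: "'a::topological_space measure \<Rightarrow> bool" where
  "borel_prob \<mu> \<longleftrightarrow> prob_space \<mu> \<and> sets \<mu> = sets borel"

definition gauss :: "'a::euclidean_space \<Rightarrow> real" where
  "gauss x = (2 * pi) powr (- (real DIM('a) / 2)) * exp (- (norm x)\<^sup>2 / 2)"

definition gauss_conv :: "'a::euclidean_space measure \<Rightarrow> 'a \<Rightarrow> real" where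
  "gauss_conv \<eta> x = (\<integral>y. gauss (x - y) \<partial>\<eta>)"

definition fourier :: "('a::euclidean_space \<Rightarrow> complex) \<Rightarrow> 'a \<Rightarrow> complex" where
  "fourier g \<xi> =
     complex_of_real ((2 * pi) powr (- (real DIM('a) / 2))) *
     (\<integral>x. exp (- (\<i> * complex_of_real (x \<bullet> \<xi>))) * g x \<partial>lborel)"

definition fourier_measure :: "'a::euclidean_space measure \<Rightarrow> 'a \<Rightarrow> complex" where
  "fourier_measure \<mu> \<xi> =
     complex_of_real ((2 * pi) powr (- (real DIM('a) / 2))) *
     (\<integral>x. exp (- (\<i> * complex_of_real (x \<bullet> \<xi>))) \<partial>\<mu>)"

definition fourier_inf :: "'a::euclidean_space measure \<Rightarrow> real" where
  "fourier_inf \<eta> = (INF \<xi>. cmod (fourier_measure \<eta> \<xi>))"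

definition dilate :: "real \<Rightarrow> ('a::euclidean_space \<Rightarrow> real) \<Rightarrow> 'a \<Rightarrow> real" where
  "dilate \<nu> \<phi> x = \<nu> ^ DIM('a) * \<phi> (\<nu> *\<^sub>R x)"

definition mixtures :: "('a::euclidean_space \<Rightarrow> real) \<Rightarrow> real \<Rightarrow> ('a \<Rightarrow> real) set" where
  "mixtures \<phi> \<nu> = {\<lambda>x. \<integral>\<mu>. dilate \<nu> \<phi> (x - \<mu>) \<partial>G | G. borel_prob G}"

text \<open>An estimator sends a sample (a point of the n-fold product, indexed by \<open>{..<n}\<close>) to a
  real function; measurability is joint in the sample and the evaluation point.\<close>

definition estimators :: "nat \<Rightarrow> ((nat \<Rightarrow> 'a::euclidean_space) \<Rightarrow> 'a \<Rightarrow> real) set" where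
  "estimators n =
     {f. case_prod f \<in> borel_measurable ((\<Pi>\<^sub>M i\<in>{..<n}. (borel :: 'a measure)) \<Otimes>\<^sub>M borel)}"

definition l2_loss :: "('a::euclidean_space \<Rightarrow> real) \<Rightarrow> ('a \<Rightarrow> real) \<Rightarrow> ennreal" where
  "l2_loss g f = (if g \<in> L2 then \<integral>\<^sup>+x. ennreal ((g x - f x)\<^sup>2) \<partial>lborel else \<infinity>)"

definition iid_law :: "nat \<Rightarrow> ('a::euclidean_space \<Rightarrow> real) \<Rightarrow> (nat \<Rightarrow> 'a) measure" where
  "iid_law n f = (\<Pi>\<^sub>M i\<in>{..<n}. density lborel (\<lambda>x. ennreal (f x)))"

definition minimax_risk :: "nat \<Rightarrow> ('a::euclidean_space \<Rightarrow> real) set \<Rightarrow> ennreal" where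
  "minimax_risk n F =
     (INF est\<in>estimators n. SUP f\<in>F. \<integral>\<^sup>+X. l2_loss (est X) f \<partial>iid_law n f)"

end

theory Submission
  imports Defs
begin

text \<open>
  The lower bound comes from a hypercube of mixtures that differ by high-frequency sine waves. Write
  N(s) for the Gaussian density with precision s. Rescaling the measure \<open>\<eta>\<close> by \<open>1/\<nu>\<close> to \<open>\<eta>'\<close> turns the
  kernel into \<open>N(\<nu>\<^sup>2) * \<eta>'\<close>. The hypotheses have mixing densities
  \<open>N(s) (1 + \<Sum>m\<in>S. \<epsilon> m sin (\<kappa> m \<bullet> x))\<close>, where the set \<open>S\<close> of switched-on modes is the vertex of the cube.
  Smoothing with \<open>N(\<nu>\<^sup>2)\<close> maps a modulated Gaussian to a modulated Gaussian: the envelope becomes wider, the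
  frequency \<open>\<kappa> m\<close> shrinks by a fixed factor to a lattice point \<open>k m\<close>, and the amplitude drops by a factor
  \<open>exp (- const * |m|\<^sup>2)\<close>. The amplitudes are chosen so that all smoothed amplitudes equal the same
  \<open>\<sigma> = \<tau> / sqrt n\<close>. The mixing density stays positive as long as the \<open>\<epsilon> m\<close> sum to at most 1/2, which leaves room for
  all \<open>m\<close> whose entries are at most a constant times \<open>sqrt (ln n)\<close>, and there are of order \<open>(ln n) powr (d/2)\<close> of these.

  Switching one mode changes a density by a relative amount of order \<open>1 / sqrt n\<close>, because
  \<open>|\<eta>' * (p sin)| \<le> \<eta>' * p\<close>; so n observations cannot reliably detect the switch, and each mode costs the
  estimator a constant multiple of its squared amplitude (\<open>two_point_lower_bound\<close>, summed over modes in
  \<open>assouad_lower_bound\<close>). This needs linear functionals which detect single modes and which together are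
  dominated by the squared L2 norm. Sine waves with lattice frequencies, restricted to a period cube and
  divided by the Gaussian envelope p, satisfy such a bound by Bessel's inequality (\<open>weighted_bessel\<close>).

  The remaining point is that \<open>\<eta>'\<close> does not destroy a mode, and here the hypothesis on the Fourier transform
  enters. If p varies slowly on the scale where \<open>\<eta>'\<close> lives, then \<open>\<eta>' * (p sin)\<close> is close to p times the
  average of the shifted sine wave, which is a sine wave with amplitude \<open>|\<integral> exp (- i k \<bullet> y) \<eta>'(dy)|\<close> and some
  new phase (\<open>sine_averaged_phase\<close>). This amplitude is bounded below, so a sufficiently wide envelope
  (\<open>slowly_varying_gaussian\<close>) makes the error small compared with it (\<open>smoothed_sine_separation\<close>).

  The regularity claims hold because convolving the Gaussian with a probability measure preserves
  total mass and the uniform bound, and does not increase the modulus of the Fourier transform.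
\<close>

section \<open>Gaussian densities and their Fourier transforms\<close>

lemma lborel_integral_prod_Basis:
  fixes g :: "'a::euclidean_space \<Rightarrow> real \<Rightarrow> complex"
  assumes int: "\<And>b. b \<in> Basis \<Longrightarrow> integrable lborel (g b)"
  shows "integrable lborel (\<lambda>x::'a. \<Prod>b\<in>Basis. g b (x \<bullet> b))"
    and "(\<integral>x. (\<Prod>b\<in>Basis. g b (x \<bullet> b)) \<partial>(lborel :: 'a measure)) = (\<Prod>b\<in>Basis. \<integral>y. g b y \<partial>lborel)"
proof -
  interpret product_sigma_finite "\<lambda>_::'a. lborel :: real measure"
    by (rule product_sigma_finite.intro) (rule sigma_finite_lborel)
  \<comment> \<open>Extending by zero makes the family measurable at every index, inside \<open>Basis\<close> or not.\<close>
  define h where "h b = (\<lambda>y. if b \<in> Basis then g b y else 0)" for b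
  have h_int: "integrable lborel (h b)" for b
    using int by (cases "b \<in> Basis") (auto simp: h_def)
  then have [measurable]: "h b \<in> borel_measurable borel" for b
    using borel_measurable_integrable by fastforce
  let ?P = "\<Pi>\<^sub>M b\<in>(Basis :: 'a set). (lborel :: real measure)"
  let ?e = "\<lambda>f. \<Sum>b\<in>(Basis :: 'a set). f b *\<^sub>R b :: 'a"
  have e: "?e \<in> measurable ?P borel" by measurable
  have m: "(\<lambda>x::'a. \<Prod>b\<in>Basis. h b (x \<bullet> b)) \<in> borel_measurable borel" by measurable
  have eq: "(\<Prod>b\<in>Basis. h b (?e f \<bullet> b)) = (\<Prod>b\<in>Basis. h b (f b))" for f
    by (intro prod.cong refl) simp
  have *: "(\<Prod>b\<in>Basis. g b (x \<bullet> b)) = (\<Prod>b\<in>Basis. h b (x \<bullet> b))" for x :: 'a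
    by (simp add: h_def)
  have "integrable ?P (\<lambda>f. \<Prod>b\<in>Basis. h b (f b))"
    by (intro product_integrable_prod h_int) auto
  then show "integrable lborel (\<lambda>x::'a. \<Prod>b\<in>Basis. g b (x \<bullet> b))"
    unfolding * by (subst lborel_eq, subst integrable_distr_eq[OF e m]) (simp only: eq)
  have "(\<integral>x. (\<Prod>b\<in>Basis. h b (x \<bullet> b)) \<partial>(lborel :: 'a measure)) = (\<integral>f. (\<Prod>b\<in>Basis. h b (f b)) \<partial>?P)"
    by (subst lborel_eq, subst integral_distr[OF e m]) (simp only: eq)
  also have "\<dots> = (\<Prod>b\<in>Basis. \<integral>y. h b y \<partial>lborel)"
    by (intro product_integral_prod h_int) auto
  finally show "(\<integral>x. (\<Prod>b\<in>Basis. g b (x \<bullet> b)) \<partial>(lborel :: 'a measure)) = (\<Prod>b\<in>Basis. \<integral>y. g b y \<partial>lborel)"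
    unfolding * by (simp add: h_def)
qed

lemma normal_density_fourier:
  assumes "\<sigma> > 0"
  shows "integrable lborel (\<lambda>x. complex_of_real (normal_density 0 \<sigma> x) * cis (t * x))"
    and "(\<integral>x. complex_of_real (normal_density 0 \<sigma> x) * cis (t * x) \<partial>lborel)
       = complex_of_real (exp (- (\<sigma>\<^sup>2 * t\<^sup>2) / 2))"
proof -
  have nd: "normal_density 0 \<sigma> (\<sigma> * x) = std_normal_density x / \<sigma>" for x
    using assms by (simp add: normal_density_def real_sqrt_mult power_mult_distrib)
  show "integrable lborel (\<lambda>x. complex_of_real (normal_density 0 \<sigma> x) * cis (t * x))"
    by (rule Bochner_Integration.integrable_bound[OF integrable_normal_density[of \<sigma> 0]])
       (use assms in \<open>auto simp: norm_mult cis_conv_exp intro!: borel_measurable_times\<close>)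
  have "(\<integral>x. complex_of_real (normal_density 0 \<sigma> x) * cis (t * x) \<partial>lborel)
      = (\<integral>x. complex_of_real (std_normal_density x) * cis (t * \<sigma> * x) \<partial>lborel)"
  proof (subst lborel_integral_real_affine[where c=\<sigma> and t=0])
    have "\<bar>\<sigma>\<bar> *\<^sub>R (complex_of_real (normal_density 0 \<sigma> (0 + \<sigma> * x)) * cis (t * (0 + \<sigma> * x)))
        = complex_of_real (std_normal_density x) * cis (t * \<sigma> * x)" for x
      using assms by (simp add: nd scaleR_conv_of_real mult.assoc)
    then show "\<bar>\<sigma>\<bar> *\<^sub>R (\<integral>x. complex_of_real (normal_density 0 \<sigma> (0 + \<sigma> * x)) * cis (t * (0 + \<sigma> * x)) \<partial>lborel)
        = (\<integral>x. complex_of_real (std_normal_density x) * cis (t * \<sigma> * x) \<partial>lborel)"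
      by (simp only: integral_scaleR_right[symmetric])
  qed (use assms in simp)
  also have "\<dots> = char std_normal_distribution (t * \<sigma>)"
    unfolding char_def by (subst integral_density)
      (auto simp: scaleR_conv_of_real cis_conv_exp)
  finally show "(\<integral>x. complex_of_real (normal_density 0 \<sigma> x) * cis (t * x) \<partial>lborel)
       = complex_of_real (exp (- (\<sigma>\<^sup>2 * t\<^sup>2) / 2))"
    by (simp add: char_std_normal_distribution power_mult_distrib mult.commute)
qed

text \<open>The centred Gaussian density with covariance matrix \<open>1/s\<close> times the identity. Parametrizing by the precision
  makes products of Gaussians, which are what convolutions integrate, additive in the parameter.\<close>

definition gaussian :: "real \<Rightarrow> 'a::euclidean_space \<Rightarrow> real" where
  "gaussian s x = (s / (2 * pi)) powr (real DIM('a) / 2) * exp (- s * (norm x)\<^sup>2 / 2)"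

lemma gaussian_pos: "s > 0 \<Longrightarrow> gaussian s x > 0"
  by (simp add: gaussian_def)

lemma gaussian_measurable [measurable]: "gaussian s \<in> borel_measurable borel"
  unfolding gaussian_def by measurable

lemma gaussian_prod:
  assumes "s > 0"
  shows "gaussian s (x::'a::euclidean_space) = (\<Prod>b\<in>Basis. normal_density 0 (1 / sqrt s) (x \<bullet> b))"
proof -
  have "normal_density 0 (1 / sqrt s) y = (s / (2 * pi)) powr (1 / 2) * exp (- s * y\<^sup>2 / 2)" for y
    using assms by (simp add: normal_density_def real_sqrt_divide power_divide powr_half_sqrt)
  then have "(\<Prod>b\<in>Basis. normal_density 0 (1 / sqrt s) (x \<bullet> b))
      = ((s / (2 * pi)) powr (1 / 2)) ^ DIM('a) * exp (\<Sum>b\<in>Basis. - s * (x \<bullet> b)\<^sup>2 / 2)"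
    by (simp add: prod.distrib exp_sum)
  also have "(\<Sum>b\<in>Basis. - s * (x \<bullet> b)\<^sup>2 / 2) = - s * (norm x)\<^sup>2 / 2"
    unfolding power2_norm_eq_inner euclidean_inner[of x x]
    by (simp add: sum_distrib_left sum_divide_distrib sum_negf power2_eq_square)
  also have "((s / (2 * pi)) powr (1 / 2)) ^ DIM('a) = (s / (2 * pi)) powr (real DIM('a) / 2)"
    using assms by (simp add: powr_realpow[symmetric] powr_powr)
  finally show ?thesis by (simp add: gaussian_def)
qed

lemma cis_sum: "finite A \<Longrightarrow> cis (\<Sum>b\<in>A. f b) = (\<Prod>b\<in>A. cis (f b))"
  by (induction rule: finite_induct) (auto simp: cis_mult[symmetric])

lemma gaussian_fourier:
  fixes \<kappa> :: "'a::euclidean_space"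
  assumes "s > 0"
  shows "integrable lborel (\<lambda>x. complex_of_real (gaussian s x) * cis (\<kappa> \<bullet> x))"
    and "(\<integral>x. complex_of_real (gaussian s x) * cis (\<kappa> \<bullet> x) \<partial>lborel)
       = complex_of_real (exp (- (norm \<kappa>)\<^sup>2 / (2 * s)))"
proof -
  define g where "g b y = complex_of_real (normal_density 0 (1 / sqrt s) y) * cis ((\<kappa> \<bullet> b) * y)" for b :: 'a and y
  have eq: "complex_of_real (gaussian s x) * cis (\<kappa> \<bullet> x) = (\<Prod>b\<in>Basis. g b (x \<bullet> b))" for x
    unfolding g_def gaussian_prod[OF assms] euclidean_inner[of \<kappa> x]
    by (simp add: prod.distrib cis_sum)
  have gi: "integrable lborel (g b)" for b
    unfolding g_def using assms by (intro normal_density_fourier) auto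
  show "integrable lborel (\<lambda>x. complex_of_real (gaussian s x) * cis (\<kappa> \<bullet> x))"
    unfolding eq by (intro lborel_integral_prod_Basis gi)
  have "(\<integral>x. complex_of_real (gaussian s x) * cis (\<kappa> \<bullet> x) \<partial>lborel)
      = (\<Prod>b\<in>Basis. complex_of_real (exp (- ((1 / sqrt s)\<^sup>2 * (\<kappa> \<bullet> b)\<^sup>2) / 2)))"
    unfolding eq lborel_integral_prod_Basis(2)[OF gi]
    unfolding g_def using assms by (intro prod.cong refl normal_density_fourier(2)) simp
  also have "\<dots> = complex_of_real (exp (\<Sum>b\<in>Basis. - ((1 / sqrt s)\<^sup>2 * (\<kappa> \<bullet> b)\<^sup>2) / 2))"
    by (subst exp_sum) auto
  also have "(\<Sum>b\<in>Basis. - ((1 / sqrt s)\<^sup>2 * (\<kappa> \<bullet> b)\<^sup>2) / 2) = - (norm \<kappa>)\<^sup>2 / (2 * s)"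
    unfolding power2_norm_eq_inner euclidean_inner[of \<kappa> \<kappa>] using assms
    by (simp add: sum_distrib_left sum_divide_distrib sum_negf power2_eq_square field_simps)
  finally show "(\<integral>x. complex_of_real (gaussian s x) * cis (\<kappa> \<bullet> x) \<partial>lborel)
       = complex_of_real (exp (- (norm \<kappa>)\<^sup>2 / (2 * s)))" .
qed

lemma gaussian_has_integral:
  assumes "s > 0"
  shows "integrable lborel (gaussian s :: 'a::euclidean_space \<Rightarrow> real)"
    and "(\<integral>x. gaussian s (x::'a) \<partial>lborel) = 1"
proof -
  have i: "integrable lborel (\<lambda>x::'a. complex_of_real (gaussian s x))"
    using gaussian_fourier(1)[OF assms, of "0::'a"] by simp
  from integrable_Re[OF this] show "integrable lborel (gaussian s :: 'a \<Rightarrow> real)" by simp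
  then show "(\<integral>x. gaussian s (x::'a) \<partial>lborel) = 1"
    using gaussian_fourier(2)[OF assms, of "0::'a"] by simp
qed

lemma lborel_integrable_translate:
  fixes f :: "'a::euclidean_space \<Rightarrow> 'b::{banach, second_countable_topology}"
  shows "integrable lborel f \<Longrightarrow> integrable lborel (\<lambda>x. f (x - c))"
  using integrable_distr[of "(+) (- c)" lborel borel f] lborel_distr_plus[of "- c"]
  by simp

lemma lborel_integral_translate:
  fixes f :: "'a::euclidean_space \<Rightarrow> 'b::{banach, second_countable_topology}"
  assumes "f \<in> borel_measurable borel"
  shows "(\<integral>x. f (x - c) \<partial>lborel) = (\<integral>x. f x \<partial>lborel)"
  using integral_distr[of "(+) (- c)" lborel borel f] lborel_distr_plus[of "- c"] assms
  by simp

text \<open>Completing the square: as a function of \<open>y\<close> the product of the two Gaussians is \<open>gaussian q x\<close> times a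
  Gaussian centred at \<open>(t / (s + t)) x\<close> with precision \<open>s + t\<close>. Its Fourier transform at \<open>\<kappa>\<close> supplies the damping
  factor, and its centre the phase, i.e. the new frequency \<open>(t / (s + t)) \<kappa>\<close>.\<close>

lemma gaussian_convolution:
  fixes x \<kappa> :: "'a::euclidean_space"
  assumes "s > 0" "t > 0"
  defines "q \<equiv> s * t / (s + t)"
  shows "(\<integral>y. gaussian t (x - y) * gaussian s y \<partial>lborel) = gaussian q x" (is ?A)
    and "(\<integral>y. gaussian t (x - y) * gaussian s y * sin (\<kappa> \<bullet> y) \<partial>lborel)
       = exp (- (norm \<kappa>)\<^sup>2 / (2 * (s + t))) * gaussian q x * sin ((t / (s + t)) * (\<kappa> \<bullet> x))" (is ?B)
    and "integrable lborel (\<lambda>y. gaussian t (x - y) * gaussian s y)" (is ?C)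
proof -
  define r where "r = t / (s + t)"
  have st: "s + t > 0" "s + t \<noteq> 0" using assms by auto
  have split: "gaussian t (x - y) * gaussian s y = gaussian q x * gaussian (s + t) (y - r *\<^sub>R x)" for y
  proof -
    have c: "(t / (2 * pi)) powr d * (s / (2 * pi)) powr d
        = (q / (2 * pi)) powr d * ((s + t) / (2 * pi)) powr d" for d
    proof -
      have "t / (2 * pi) * (s / (2 * pi)) = q / (2 * pi) * ((s + t) / (2 * pi))"
        using st by (simp add: q_def)
      then have "(t / (2 * pi) * (s / (2 * pi))) powr d = (q / (2 * pi) * ((s + t) / (2 * pi))) powr d"
        by (simp only:)
      moreover have "0 \<le> t / (2 * pi)" "0 \<le> s / (2 * pi)" "0 \<le> q / (2 * pi)" "0 \<le> (s + t) / (2 * pi)"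
        using assms by (auto simp: q_def)
      ultimately show ?thesis
        by (simp only: powr_mult)
    qed
    have e: "- t * (norm (x - y))\<^sup>2 / 2 + - s * (norm y)\<^sup>2 / 2
        = - q * (norm x)\<^sup>2 / 2 + - (s + t) * (norm (y - r *\<^sub>R x))\<^sup>2 / 2"
    proof -
      have h: "(norm (x - y))\<^sup>2 = (norm x)\<^sup>2 - 2 * (x \<bullet> y) + (norm y)\<^sup>2"
        by (simp add: power2_norm_eq_inner algebra_simps inner_commute)
      have k: "(norm (y - r *\<^sub>R x))\<^sup>2 = (norm y)\<^sup>2 - 2 * r * (x \<bullet> y) + r\<^sup>2 * (norm x)\<^sup>2"
        by (simp add: power2_norm_eq_inner inner_diff_left inner_diff_right inner_commute algebra_simps)
           (simp add: power2_eq_square)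
      have r1: "(s + t) * r = t"
        using st by (simp add: r_def)
      have "q + (s + t) * r\<^sup>2 = q + ((s + t) * r) * r"
        by (simp add: power2_eq_square)
      also have "\<dots> = (t * (s + t)) / (s + t)"
        unfolding r1 unfolding q_def r_def by (simp only: add_divide_distrib times_divide_eq_right distrib_left mult.commute[of s t])
      finally have q1: "q + (s + t) * r\<^sup>2 = t"
        using st by simp
      have "- q * (norm x)\<^sup>2 / 2 + - (s + t) * (norm (y - r *\<^sub>R x))\<^sup>2 / 2
         = - (q + (s + t) * r\<^sup>2) * (norm x)\<^sup>2 / 2 + ((s + t) * r) * (x \<bullet> y) - (s + t) * (norm y)\<^sup>2 / 2"
        unfolding k by (simp add: algebra_simps) (simp add: field_simps)
      also have "\<dots> = - t * (norm (x - y))\<^sup>2 / 2 + - s * (norm y)\<^sup>2 / 2"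
        unfolding r1 q1 h by (simp add: field_simps)
      finally show ?thesis ..
    qed
    let ?d = "real DIM('a) / 2"
    have "gaussian t (x - y) * gaussian s y = ((t / (2 * pi)) powr ?d * (s / (2 * pi)) powr ?d)
        * exp (- t * (norm (x - y))\<^sup>2 / 2 + - s * (norm y)\<^sup>2 / 2)"
      unfolding gaussian_def exp_add by (simp only: mult_ac)
    also have "\<dots> = gaussian q x * gaussian (s + t) (y - r *\<^sub>R x)"
      unfolding c e gaussian_def exp_add by (simp only: mult_ac)
    finally show ?thesis .
  qed
  show ?C
    unfolding split using lborel_integrable_translate[OF gaussian_has_integral(1)[OF st(1), where 'a='a]]
    by (intro integrable_mult_right)
  show ?A
    unfolding split using st(1)
    by (simp add: lborel_integral_translate gaussian_has_integral(2))
  define z where "z = cis (\<kappa> \<bullet> (r *\<^sub>R x))"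
  have cis: "cis (\<kappa> \<bullet> y) = z * cis (\<kappa> \<bullet> (y - r *\<^sub>R x))" for y
    unfolding z_def cis_mult by (simp add: inner_diff_right)
  have m: "(\<lambda>y. complex_of_real (gaussian (s + t) y) * cis (\<kappa> \<bullet> y)) \<in> borel_measurable borel"
    unfolding cis_conv_exp by measurable
  have eq: "complex_of_real (gaussian t (x - y) * gaussian s y) * cis (\<kappa> \<bullet> y) = complex_of_real (gaussian q x) * z *
      (complex_of_real (gaussian (s + t) (y - r *\<^sub>R x)) * cis (\<kappa> \<bullet> (y - r *\<^sub>R x)))" for y
    unfolding split cis[of y] by (simp add: mult_ac)
  have int: "integrable lborel (\<lambda>y. complex_of_real (gaussian t (x - y) * gaussian s y) * cis (\<kappa> \<bullet> y))"
    unfolding eq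
    by (intro integrable_mult_right lborel_integrable_translate[OF gaussian_fourier(1)[OF st(1)]])
  have "(\<integral>y. complex_of_real (gaussian t (x - y) * gaussian s y) * cis (\<kappa> \<bullet> y) \<partial>lborel)
      = complex_of_real (gaussian q x) * z * complex_of_real (exp (- (norm \<kappa>)\<^sup>2 / (2 * (s + t))))"
    unfolding eq
    by (simp only: integral_mult_right_zero lborel_integral_translate[OF m] gaussian_fourier(2)[OF st(1)])
  from arg_cong[OF this, of Im] show ?B
    unfolding integral_Im[OF int, symmetric] z_def by (simp add: r_def mult_ac)
qed

section \<open>Square-integrable functions\<close>

lemma L2_mult_integrable:
  assumes "f \<in> L2" "g \<in> L2"
  shows "integrable lborel (\<lambda>x. f x * g x)"
proof -
  have m [measurable]: "f \<in> borel_measurable borel" "g \<in> borel_measurable borel"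
    and i: "integrable lborel (\<lambda>x. (f x)\<^sup>2)" "integrable lborel (\<lambda>x. (g x)\<^sup>2)"
    using assms by (auto simp: L2_def)
  have "\<bar>a * b\<bar> \<le> \<bar>a\<^sup>2 + b\<^sup>2\<bar>" for a b :: real
  proof -
    have "0 \<le> (\<bar>a\<bar> - \<bar>b\<bar>)\<^sup>2" by simp
    then have "2 * \<bar>a * b\<bar> \<le> a\<^sup>2 + b\<^sup>2" by (simp add: power2_diff abs_mult mult.assoc)
    moreover have "0 \<le> a\<^sup>2 + b\<^sup>2" by simp
    ultimately show ?thesis by linarith
  qed
  then show ?thesis
    by (intro Bochner_Integration.integrable_bound[OF Bochner_Integration.integrable_add[OF i]]) auto
qed

lemma L2_diff:
  assumes "f \<in> L2" "g \<in> L2"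
  shows "(\<lambda>x. f x - g x) \<in> L2"
proof -
  have m: "f \<in> borel_measurable borel" "g \<in> borel_measurable borel"
    and i: "integrable lborel (\<lambda>x. (f x)\<^sup>2)" "integrable lborel (\<lambda>x. (g x)\<^sup>2)"
    using assms by (auto simp: L2_def)
  have "integrable lborel (\<lambda>x. (f x)\<^sup>2 + (g x)\<^sup>2 - 2 * (f x * g x))"
    using i L2_mult_integrable[OF assms] by auto
  then show ?thesis
    using m by (simp add: L2_def power2_diff mult.assoc)
qed

section \<open>Orthogonal sine waves on a period cube\<close>

text \<open>The side \<open>2 pi / \<delta>\<close> is the common period, in each coordinate direction, of all waves whose frequency is a
  \<open>lattice_point \<delta> m\<close>.\<close>

definition cube :: "real \<Rightarrow> 'a::euclidean_space set" where
  "cube \<delta> = cbox (- (pi / \<delta>) *\<^sub>R One) ((pi / \<delta>) *\<^sub>R One)"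

definition lattice_point :: "real \<Rightarrow> ('a::euclidean_space \<Rightarrow> int) \<Rightarrow> 'a" where
  "lattice_point \<delta> m = (\<Sum>b\<in>Basis. (\<delta> * of_int (m b)) *\<^sub>R b)"

lemma cube_sets [measurable]: "cube \<delta> \<in> sets borel"
  by (simp add: cube_def)

lemma mem_cube_iff: "x \<in> cube \<delta> \<longleftrightarrow> (\<forall>b\<in>Basis. - (pi / \<delta>) \<le> x \<bullet> b \<and> x \<bullet> b \<le> pi / \<delta>)"
  by (auto simp: cube_def mem_box)

lemma integrable_on_cube:
  fixes f :: "'a::euclidean_space \<Rightarrow> real"
  assumes "f \<in> borel_measurable borel" "\<And>x. x \<in> cube \<delta> \<Longrightarrow> \<bar>f x\<bar> \<le> B"
  shows "integrable lborel (\<lambda>x. indicator (cube \<delta>) x * f x)"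
proof (rule Bochner_Integration.integrable_bound)
  have "emeasure lborel (cube \<delta> :: 'a set) < \<infinity>"
    unfolding cube_def by (rule emeasure_lborel_cbox_finite)
  then show "integrable lborel (\<lambda>x::'a. B * indicator (cube \<delta>) x :: real)"
    by (intro integrable_mult_right integrable_real_indicator) auto
  show "AE x in lborel. norm (indicator (cube \<delta>) x * f x) \<le> norm (B * indicator (cube \<delta>) x)"
  proof (rule AE_I2)
    fix x
    show "norm (indicator (cube \<delta>) x * f x) \<le> norm (B * indicator (cube \<delta>) x)"
      using assms(2)[of x] by (cases "x \<in> cube \<delta>") auto
  qed
qed (use assms(1) in measurable)

lemma integral_cis_full_periods:
  fixes j :: int
  assumes "\<delta> > 0" "j \<noteq> 0"
  shows "(\<integral>y. indicator {- (pi / \<delta>)..pi / \<delta>} y *\<^sub>R cis (\<delta> * of_int j * y) \<partial>lborel) = 0"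
proof -
  let ?c = "\<delta> * of_int j"
  have c: "?c \<noteq> 0" using assms by auto
  have "(\<integral>y. indicator {- (pi / \<delta>)..pi / \<delta>} y *\<^sub>R cis (?c * y) \<partial>lborel)
     = cis (?c * (pi / \<delta>)) / (\<i> * ?c) - cis (?c * (- (pi / \<delta>))) / (\<i> * ?c)"
  proof (rule integral_FTC_atLeastAtMost)
    fix x :: real
    show "((\<lambda>y. cis (?c * y) / (\<i> * ?c)) has_vector_derivative cis (?c * x)) (at x within {- (pi / \<delta>)..pi / \<delta>})"
      unfolding cis_conv_exp using c
      by (auto intro!: derivative_eq_intros has_vector_derivative_real_field
        simp: scaleR_conv_of_real mult.commute[of "exp _" \<i>])
  qed (use assms in \<open>auto intro!: continuous_intros\<close>)
  also have "cis (?c * (pi / \<delta>)) = cis (?c * (- (pi / \<delta>)))"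
  proof -
    have "cis (?c * (pi / \<delta>)) = cis (?c * (- (pi / \<delta>))) * cis (2 * pi * of_int j)"
      unfolding cis_mult using assms by (simp add: field_simps)
    also have "cis (2 * pi * of_int j) = 1"
      by (rule cis_multiple_2pi) simp
    finally show ?thesis by simp
  qed
  finally show ?thesis by simp
qed

lemma cube_integral_cos:
  fixes j :: "'a::euclidean_space \<Rightarrow> int"
  assumes "\<delta> > 0" "b0 \<in> Basis" "j b0 \<noteq> 0"
  shows "(\<integral>x. indicator (cube \<delta>) x * cos (lattice_point \<delta> j \<bullet> x + c) \<partial>lborel) = 0"
proof -
  define g where "g b y = indicator {- (pi / \<delta>)..pi / \<delta>} y *\<^sub>R cis (\<delta> * of_int (j b) * y)" for b :: 'a and y :: real
  have gi: "integrable lborel (g b)" for b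
    unfolding g_def by (intro borel_integrable_compact) (auto intro!: continuous_intros)
  have ind: "indicator (cube \<delta>) x = (\<Prod>b\<in>Basis. indicator {- (pi / \<delta>)..pi / \<delta>} (x \<bullet> b) :: real)" for x :: 'a
    by (auto simp: indicator_def mem_cube_iff prod_zero_iff)
  have dot: "lattice_point \<delta> j \<bullet> x = (\<Sum>b\<in>Basis. \<delta> * of_int (j b) * (x \<bullet> b))" for x
    by (simp add: lattice_point_def inner_sum_left inner_sum_right inner_commute)
  have eq: "indicator (cube \<delta>) x *\<^sub>R cis (lattice_point \<delta> j \<bullet> x) = (\<Prod>b\<in>Basis. g b (x \<bullet> b))" for x
    unfolding ind dot g_def by (simp add: cis_sum scaleR_conv_of_real prod.distrib)
  have int: "integrable lborel (\<lambda>x. indicator (cube \<delta>) x *\<^sub>R cis (lattice_point \<delta> j \<bullet> x) * cis c)"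
    unfolding eq by (intro integrable_mult_left lborel_integral_prod_Basis gi)
  have "(\<integral>x. indicator (cube \<delta>) x *\<^sub>R cis (lattice_point \<delta> j \<bullet> x) * cis c \<partial>lborel)
      = (\<Prod>b\<in>Basis. \<integral>y. g b y \<partial>lborel) * cis c"
    unfolding eq by (simp add: lborel_integral_prod_Basis(2)[OF gi])
  also have "\<dots> = 0"
    using assms integral_cis_full_periods[of \<delta> "j b0"] by (auto simp: g_def intro!: bexI[of _ b0])
  finally have "Re (\<integral>x. indicator (cube \<delta>) x *\<^sub>R cis (lattice_point \<delta> j \<bullet> x) * cis c \<partial>lborel) = 0"
    by simp
  then show ?thesis
    unfolding integral_Re[OF int, symmetric] by (simp add: cos_add right_diff_distrib mult.assoc)
qed

text \<open>The product of two waves is a difference of cosines with frequencies \<open>m - m'\<close> and \<open>m + m'\<close>. Positive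
  entries keep \<open>m + m'\<close> away from zero, which is why the phases \<open>\<beta>\<close> and \<open>\<beta>'\<close> may be arbitrary.\<close>

lemma cube_integral_sin_sin:
  fixes m m' :: "'a::euclidean_space \<Rightarrow> int"
  assumes "\<delta> > 0" and m: "\<And>b. b \<in> Basis \<Longrightarrow> m b > 0" and m': "\<And>b. b \<in> Basis \<Longrightarrow> m' b > 0"
  shows "\<exists>b\<in>Basis. m b \<noteq> m' b \<Longrightarrow>
      (\<integral>x. indicator (cube \<delta>) x * (sin (lattice_point \<delta> m \<bullet> x + \<beta>) * sin (lattice_point \<delta> m' \<bullet> x + \<beta>')) \<partial>lborel) = 0"
    and "(\<integral>x. indicator (cube \<delta>) x * (sin (lattice_point \<delta> m \<bullet> x + \<beta>))\<^sup>2 \<partial>lborel)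
       = measure lborel (cube \<delta> :: 'a set) / 2"
proof -
  have sub: "lattice_point \<delta> m - lattice_point \<delta> n = lattice_point \<delta> (\<lambda>b. m b - n b)"
    and add: "lattice_point \<delta> m + lattice_point \<delta> n = lattice_point \<delta> (\<lambda>b. m b + n b)" for m n :: "'a \<Rightarrow> int"
    by (simp_all add: lattice_point_def sum_subtractf[symmetric] sum.distrib[symmetric] algebra_simps)
  have int: "integrable lborel (\<lambda>x. indicator (cube \<delta>) x * cos (k \<bullet> x + c))" for k :: 'a and c
    by (rule integrable_on_cube[where B=1]) auto
  have trig: "indicator (cube \<delta>) x * (sin (lattice_point \<delta> m \<bullet> x + \<beta>) * sin (lattice_point \<delta> n \<bullet> x + \<beta>')) =
     (indicator (cube \<delta>) x * cos (lattice_point \<delta> (\<lambda>b. m b - n b) \<bullet> x + (\<beta> - \<beta>'))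
      - indicator (cube \<delta>) x * cos (lattice_point \<delta> (\<lambda>b. m b + n b) \<bullet> x + (\<beta> + \<beta>'))) / 2" for n x \<beta>'
    unfolding sub[symmetric] add[symmetric] inner_add_left inner_diff_left sin_times_sin
    by (simp add: algebra_simps)
  obtain b0 :: 'a where b0: "b0 \<in> Basis" using nonempty_Basis by blast
  show "(\<integral>x. indicator (cube \<delta>) x * (sin (lattice_point \<delta> m \<bullet> x + \<beta>) * sin (lattice_point \<delta> m' \<bullet> x + \<beta>')) \<partial>lborel) = 0"
    if "\<exists>b\<in>Basis. m b \<noteq> m' b"
  proof -
    from that obtain b where b: "b \<in> Basis" "m b \<noteq> m' b" by auto
    have "m b + m' b \<noteq> 0" using m[OF b(1)] m'[OF b(1)] by linarith
    then show ?thesis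
      unfolding trig using b assms(1) by (simp add: int cube_integral_cos[of \<delta> b])
  qed
  have z: "lattice_point \<delta> (\<lambda>b. 0) = (0::'a)" by (simp add: lattice_point_def)
  have "m b0 + m b0 \<noteq> 0" using m[OF b0] by linarith
  then show "(\<integral>x. indicator (cube \<delta>) x * (sin (lattice_point \<delta> m \<bullet> x + \<beta>))\<^sup>2 \<partial>lborel)
       = measure lborel (cube \<delta> :: 'a set) / 2"
    unfolding power2_eq_square trig using b0 assms(1) int[of 0 0]
    by (simp add: int cube_integral_cos[of \<delta> b0] z)
qed

text \<open>The squared distance of \<open>g\<close> from its projection onto the span of the \<open>e k\<close> is nonnegative.\<close>

lemma bessel_inequality:
  fixes g :: "'a \<Rightarrow> real" and e :: "'k \<Rightarrow> 'a \<Rightarrow> real"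
  assumes "finite K" "N > 0"
    and g: "integrable M (\<lambda>x. (g x)\<^sup>2)"
    and ge: "\<And>k. k \<in> K \<Longrightarrow> integrable M (\<lambda>x. g x * e k x)"
    and ee: "\<And>j k. j \<in> K \<Longrightarrow> k \<in> K \<Longrightarrow> integrable M (\<lambda>x. e j x * e k x)"
    and orth: "\<And>j k. j \<in> K \<Longrightarrow> k \<in> K \<Longrightarrow> (\<integral>x. e j x * e k x \<partial>M) = (if j = k then N else 0)"
  shows "(\<Sum>k\<in>K. (\<integral>x. g x * e k x \<partial>M)\<^sup>2) \<le> N * (\<integral>x. (g x)\<^sup>2 \<partial>M)"
proof -
  define c where "c k = (\<integral>x. g x * e k x \<partial>M)" for k
  have "0 \<le> (\<integral>x. (g x - (\<Sum>k\<in>K. c k / N * e k x))\<^sup>2 \<partial>M)"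
    by simp
  also have "(\<lambda>x. (g x - (\<Sum>k\<in>K. c k / N * e k x))\<^sup>2) = (\<lambda>x. (g x)\<^sup>2 - 2 * (\<Sum>k\<in>K. c k / N * (g x * e k x))
      + (\<Sum>j\<in>K. \<Sum>k\<in>K. c j / N * (c k / N) * (e j x * e k x)))"
  proof
    fix x
    have "2 * g x * (\<Sum>k\<in>K. c k / N * e k x) = 2 * (\<Sum>k\<in>K. c k / N * (g x * e k x))"
      by (simp add: sum_distrib_left mult_ac)
    moreover have "(\<Sum>k\<in>K. c k / N * e k x)\<^sup>2 = (\<Sum>j\<in>K. \<Sum>k\<in>K. c j / N * (c k / N) * (e j x * e k x))"
      by (simp add: power2_eq_square sum_product mult_ac)
    ultimately show "(g x - (\<Sum>k\<in>K. c k / N * e k x))\<^sup>2 = (g x)\<^sup>2 - 2 * (\<Sum>k\<in>K. c k / N * (g x * e k x))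
      + (\<Sum>j\<in>K. \<Sum>k\<in>K. c j / N * (c k / N) * (e j x * e k x))"
      by (simp only: power2_diff)
  qed
  also have "(\<integral>x. (g x)\<^sup>2 - 2 * (\<Sum>k\<in>K. c k / N * (g x * e k x))
      + (\<Sum>j\<in>K. \<Sum>k\<in>K. c j / N * (c k / N) * (e j x * e k x)) \<partial>M)
     = (\<integral>x. (g x)\<^sup>2 \<partial>M) - 2 * (\<Sum>k\<in>K. c k / N * c k)
      + (\<Sum>j\<in>K. \<Sum>k\<in>K. c j / N * (c k / N) * (if j = k then N else 0))"
    using g ge ee by (simp add: orth c_def Bochner_Integration.integral_sum cong: sum.cong)
  also have "\<dots> = (\<integral>x. (g x)\<^sup>2 \<partial>M) - (\<Sum>k\<in>K. (c k)\<^sup>2) / N"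
    using \<open>N > 0\<close> \<open>finite K\<close>
    by (simp add: if_distrib sum.delta power2_eq_square sum_divide_distrib cong: if_cong)
  finally show ?thesis
    using \<open>N > 0\<close> by (simp add: c_def field_simps)
qed

lemma cube_measure_pos:
  assumes "\<delta> > 0" shows "measure lborel (cube \<delta> :: 'a::euclidean_space set) > 0"
  using assms by (simp add: cube_def content_cbox_cases prod_pos inner_diff_left)

text \<open>The functional \<open>\<psi> m\<close> first removes the envelope \<open>w\<close> and then tests against a wave on the cube. Dividing by
  \<open>w\<close> costs only a constant, since \<open>w\<close> is bounded below on the cube. The phases are free because they are
  dictated later by the smoothing measure.\<close>

lemma weighted_bessel:
  fixes w :: "'a::euclidean_space \<Rightarrow> real" and K :: "('a \<Rightarrow> int) set"
  assumes K: "finite K" "K \<subseteq> Basis \<rightarrow>\<^sub>E {0<..}" and \<delta>: "\<delta> > 0"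
    and w: "w \<in> borel_measurable borel" "c > 0" "\<And>x. x \<in> cube \<delta> \<Longrightarrow> c \<le> w x"
    and \<psi>: "\<And>m x. \<psi> m x = indicator (cube \<delta>) x * sin (lattice_point \<delta> m \<bullet> x + \<beta> m) / w x"
  shows "\<psi> m \<in> L2"
    and "h \<in> L2 \<Longrightarrow> (\<Sum>m\<in>K. (\<integral>x. h x * \<psi> m x \<partial>lborel)\<^sup>2)
          \<le> measure lborel (cube \<delta> :: 'a set) / (2 * c\<^sup>2) * (\<integral>x. (h x)\<^sup>2 \<partial>lborel)"
proof -
  note w(1)[measurable]
  have \<psi>_meas: "\<psi> m \<in> borel_measurable borel" for m
    unfolding \<psi> by measurable
  have inv: "\<bar>1 / w x\<bar> \<le> 1 / c" if "x \<in> cube \<delta>" for x :: 'a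
    using w(2) w(3)[OF that] by (simp add: frac_le)
  have "integrable lborel (\<lambda>x::'a. indicator (cube \<delta>) x * (sin (lattice_point \<delta> m \<bullet> x + \<beta> m) / w (x::'a))\<^sup>2)"
  proof (rule integrable_on_cube[where B="(1 / c)\<^sup>2"])
    fix x :: 'a assume x: "x \<in> cube \<delta>"
    have "\<bar>sin (lattice_point \<delta> m \<bullet> x + \<beta> m)\<bar> * \<bar>1 / w x\<bar> \<le> 1 * (1 / c)"
      by (intro mult_mono inv x) auto
    then have "\<bar>sin (lattice_point \<delta> m \<bullet> x + \<beta> m) / w x\<bar> \<le> 1 / c"
      by (simp add: abs_mult)
    then have "\<bar>sin (lattice_point \<delta> m \<bullet> x + \<beta> m) / w x\<bar>\<^sup>2 \<le> (1 / c)\<^sup>2"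
      by (rule power_mono) simp
    then show "\<bar>(sin (lattice_point \<delta> m \<bullet> x + \<beta> m) / w x)\<^sup>2\<bar> \<le> (1 / c)\<^sup>2"
      by (simp only: power2_abs abs_power2)
  qed measurable
  also have "(\<lambda>x. indicator (cube \<delta>) x * (sin (lattice_point \<delta> m \<bullet> x + \<beta> m) / w x)\<^sup>2) = (\<lambda>x::'a. (\<psi> m x)\<^sup>2)"
    by (auto simp: fun_eq_iff \<psi> indicator_def)
  finally show "\<psi> m \<in> L2"
    using \<psi>_meas by (simp add: L2_def)
  assume h: "h \<in> L2"
  then have [measurable]: "h \<in> borel_measurable borel" and h2: "integrable lborel (\<lambda>x. (h x)\<^sup>2)"
    by (auto simp: L2_def)
  define g where "g x = indicator (cube \<delta>) x * h x / w x" for x :: 'a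
  define e where "e m x = indicator (cube \<delta>) x * sin (lattice_point \<delta> m \<bullet> x + \<beta> m)" for m and x :: 'a
  have g_le: "(g x)\<^sup>2 \<le> (h x)\<^sup>2 / c\<^sup>2" for x
  proof (cases "x \<in> cube \<delta>")
    case True
    then have "(g x)\<^sup>2 = (h x)\<^sup>2 * (1 / w x)\<^sup>2" by (simp add: g_def power_divide)
    also have "\<dots> \<le> (h x)\<^sup>2 * (1 / c)\<^sup>2"
      using inv[OF True] w(2) by (intro mult_left_mono) (auto simp: abs_le_square_iff[symmetric])
    finally show ?thesis by (simp add: power_divide)
  qed (simp add: g_def)
  have g_int: "integrable lborel (\<lambda>x. (g x)\<^sup>2)"
    by (rule Bochner_Integration.integrable_bound[OF integrable_divide[OF h2, of "c\<^sup>2"]])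
       (use g_le in \<open>auto simp: g_def intro!: borel_measurable_power\<close>)
  have e2: "integrable lborel (\<lambda>x. e j x * e k x)" for j k
  proof -
    have "integrable lborel (\<lambda>x. indicator (cube \<delta>) x * (sin (lattice_point \<delta> j \<bullet> x + \<beta> j) * sin (lattice_point \<delta> k \<bullet> x + \<beta> k)))"
      by (rule integrable_on_cube[where B=1]) (auto simp: abs_mult mult_le_one)
    then show ?thesis
      by (rule Bochner_Integration.integrable_cong[THEN iffD1, rotated -1]) (auto simp: e_def indicator_def)
  qed
  have [measurable]: "g \<in> borel_measurable borel" "e k \<in> borel_measurable borel" for k
    unfolding g_def e_def by measurable
  have gL2: "g \<in> L2" and eL2: "e k \<in> L2" for k
    using g_int e2[of k k] by (simp_all add: L2_def power2_eq_square)
  have ge: "integrable lborel (\<lambda>x. g x * e k x)" for k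
    by (rule L2_mult_integrable[OF gL2 eL2])
  have eq: "h x * \<psi> m x = g x * e m x" for m x
    by (simp add: \<psi> g_def e_def indicator_def)
  have orth: "(\<integral>x. e j x * e k x \<partial>lborel) = (if j = k then measure lborel (cube \<delta> :: 'a set) / 2 else 0)"
    if "j \<in> K" "k \<in> K" for j k
  proof -
    have pos: "j b > 0" "k b > 0" if "b \<in> Basis" for b
      using K(2) \<open>j \<in> K\<close> \<open>k \<in> K\<close> that by (auto simp: PiE_iff subset_iff)
    have "(\<integral>x. e j x * e k x \<partial>lborel) = (\<integral>x. indicator (cube \<delta>) x * (sin (lattice_point \<delta> j \<bullet> x + \<beta> j) * sin (lattice_point \<delta> k \<bullet> x + \<beta> k)) \<partial>lborel)"
      by (intro Bochner_Integration.integral_cong) (auto simp: e_def indicator_def)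
    moreover have "\<exists>b\<in>Basis. j b \<noteq> k b" if "j \<noteq> k"
      using that PiE_ext[of j Basis "\<lambda>_. {0<..}" k] K(2) \<open>j \<in> K\<close> \<open>k \<in> K\<close> by blast
    ultimately show ?thesis
      using cube_integral_sin_sin(1)[of \<delta> j k "\<beta> j" "\<beta> k", OF \<delta> pos]
        cube_integral_sin_sin(2)[of \<delta> j k "\<beta> j", OF \<delta> pos]
      by (cases "j = k") (simp_all add: power2_eq_square)
  qed
  have "(\<Sum>m\<in>K. (\<integral>x. h x * \<psi> m x \<partial>lborel)\<^sup>2) \<le> measure lborel (cube \<delta> :: 'a set) / 2 * (\<integral>x. (g x)\<^sup>2 \<partial>lborel)"
    unfolding eq using cube_measure_pos[OF \<delta>, where 'a='a]
    by (intro bessel_inequality K(1) g_int ge e2 orth) auto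
  also have "\<dots> \<le> measure lborel (cube \<delta> :: 'a set) / 2 * (\<integral>x. (h x)\<^sup>2 / c\<^sup>2 \<partial>lborel)"
    by (intro mult_left_mono integral_mono g_int integrable_divide h2 g_le) auto
  finally show "(\<Sum>m\<in>K. (\<integral>x. h x * \<psi> m x \<partial>lborel)\<^sup>2)
          \<le> measure lborel (cube \<delta> :: 'a set) / (2 * c\<^sup>2) * (\<integral>x. (h x)\<^sup>2 \<partial>lborel)"
    by simp
qed

section \<open>Minimax lower bounds over a hypercube of densities\<close>

lemma prob_densityD:
  assumes "f \<in> prob_densities"
  shows "f \<in> borel_measurable borel" "\<And>x. 0 \<le> f x" "integrable lborel f" "(\<integral>x. f x \<partial>lborel) = 1"
proof -
  show *: "f \<in> borel_measurable borel" "\<And>x. 0 \<le> f x" using assms by (auto simp: prob_densities_def)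
  have 1: "(\<integral>\<^sup>+x. ennreal (f x) \<partial>lborel) = 1" using assms by (auto simp: prob_densities_def)
  show "integrable lborel f"
    using * 1 by (intro integrableI_nonneg) auto
  show "(\<integral>x. f x \<partial>lborel) = 1"
    using * 1 by (subst integral_eq_nn_integral) auto
qed

lemma prob_densitiesI:
  assumes "f \<in> borel_measurable borel" "\<And>x. 0 \<le> f x" "integrable lborel f" "(\<integral>x. f x \<partial>lborel) = 1"
  shows "f \<in> prob_densities"
  using assms by (auto simp: prob_densities_def nn_integral_eq_integral)

lemma sets_iid_law [measurable_cong]: "sets (iid_law n f) = sets (\<Pi>\<^sub>M i\<in>{..<n}. borel)"
  unfolding iid_law_def by (intro sets_PiM_cong) auto

lemma iid_law_eq_density:
  fixes f :: "'a::euclidean_space \<Rightarrow> real"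
  assumes "f \<in> prob_densities"
  shows "iid_law n f = density (\<Pi>\<^sub>M i\<in>{..<n}. lborel) (\<lambda>X. ennreal (\<Prod>i<n. f (X i)))"
proof -
  note f = prob_densityD[OF assms]
  note f(1)[measurable]
  have "prob_space (density lborel (\<lambda>x. ennreal (f x)))"
    using assms by (intro prob_spaceI) (auto simp: prob_densities_def emeasure_density)
  then interpret D: product_sigma_finite "\<lambda>_::nat. density lborel (\<lambda>x. ennreal (f x))"
    by (intro product_sigma_finite.intro) (simp add: prob_space_imp_sigma_finite)
  interpret product_sigma_finite "\<lambda>_::nat. lborel :: 'a measure"
    by (intro product_sigma_finite.intro) (rule sigma_finite_lborel)
  let ?P = "\<Pi>\<^sub>M i\<in>{..<n}. (lborel :: 'a measure)"
  have "density ?P (\<lambda>X. ennreal (\<Prod>i<n. f (X i))) = iid_law n f"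
    unfolding iid_law_def
  proof (rule D.PiM_eqI)
    fix A :: "nat \<Rightarrow> 'a set"
    assume A: "\<And>i. i \<in> {..<n} \<Longrightarrow> A i \<in> sets (density lborel (\<lambda>x. ennreal (f x)))"
    then have A': "\<And>i. i \<in> {..<n} \<Longrightarrow> A i \<in> sets borel" by simp
    have PA: "Pi\<^sub>E {..<n} A \<in> sets ?P"
      using A' by (intro sets_PiM_I_finite) auto
    have "emeasure (density ?P (\<lambda>X. ennreal (\<Prod>i<n. f (X i)))) (Pi\<^sub>E {..<n} A)
       = (\<integral>\<^sup>+X. ennreal (\<Prod>i<n. f (X i)) * indicator (Pi\<^sub>E {..<n} A) X \<partial>?P)"
      using PA by (intro emeasure_density) auto
    also have "\<dots> = (\<integral>\<^sup>+X. (\<Prod>i<n. ennreal (f (X i)) * indicator (A i) (X i)) \<partial>?P)"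
    proof (intro nn_integral_cong)
      fix X assume X: "X \<in> space ?P"
      have "indicator (Pi\<^sub>E {..<n} A) X = (\<Prod>i<n. indicator (A i) (X i) :: ennreal)"
        using X by (auto simp: indicator_def space_PiM PiE_iff prod_zero_iff split: if_splits)
      then show "ennreal (\<Prod>i<n. f (X i)) * indicator (Pi\<^sub>E {..<n} A) X
          = (\<Prod>i<n. ennreal (f (X i)) * indicator (A i) (X i))"
        using f(2) by (simp add: prod.distrib prod_ennreal)
    qed
    also have "\<dots> = (\<Prod>i<n. \<integral>\<^sup>+x. ennreal (f x) * indicator (A i) x \<partial>lborel)"
      using A' by (intro product_nn_integral_prod) auto
    also have "\<dots> = (\<Prod>i<n. emeasure (density lborel (\<lambda>x. ennreal (f x))) (A i))"
      using A' by (intro prod.cong refl) (simp add: emeasure_density)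
    finally show "emeasure (density ?P (\<lambda>X. ennreal (\<Prod>i<n. f (X i)))) (Pi\<^sub>E {..<n} A)
       = (\<Prod>i\<in>{..<n}. emeasure (density lborel (\<lambda>x. ennreal (f x))) (A i))" .
  qed (auto intro!: sets_PiM_cong)
  then show ?thesis ..
qed

text \<open>Since both densities integrate to one, the first-order term of \<open>g\<^sup>2 / f\<close> around \<open>f\<close> integrates to zero and only
  the square of the relative deviation remains. This is what makes relative deviations of order \<open>1 / sqrt n\<close>
  invisible to \<open>n\<close> observations.\<close>

lemma chi_square_close_densities:
  fixes f g :: "'a::euclidean_space \<Rightarrow> real"
  assumes f: "f \<in> prob_densities" and g: "g \<in> prob_densities"
    and pos: "\<And>x. 0 < f x" and close: "\<And>x. \<bar>g x - f x\<bar> \<le> \<rho> * f x" and \<rho>: "0 \<le> \<rho>"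
  shows "integrable lborel (\<lambda>x. (g x)\<^sup>2 / f x)" and "(\<integral>x. (g x)\<^sup>2 / f x \<partial>lborel) \<le> 1 + \<rho>\<^sup>2"
proof -
  note [measurable] = prob_densityD(1)[OF f] prob_densityD(1)[OF g]
  note fi = prob_densityD(3,4)[OF f] and gi = prob_densityD(3,4)[OF g]
  have le: "(g x - f x)\<^sup>2 / f x \<le> \<rho>\<^sup>2 * f x" for x
  proof -
    have "(g x - f x)\<^sup>2 \<le> (\<rho> * f x)\<^sup>2"
      using power_mono[OF close[of x], of 2] by simp
    then show ?thesis using pos[of x] by (simp add: field_simps power2_eq_square)
  qed
  have int: "integrable lborel (\<lambda>x. (g x - f x)\<^sup>2 / f x)"
    by (rule Bochner_Integration.integrable_bound[OF integrable_mult_right[OF fi(1), of "\<rho>\<^sup>2"]])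
       (use le pos \<rho> in \<open>auto simp: less_imp_le abs_of_nonneg\<close>)
  have eq: "(g x)\<^sup>2 / f x = 2 * g x - f x + (g x - f x)\<^sup>2 / f x" for x
    using pos[of x] by (simp add: field_simps power2_eq_square)
  show "integrable lborel (\<lambda>x. (g x)\<^sup>2 / f x)"
    unfolding eq using fi gi int by simp
  have "(\<integral>x. (g x)\<^sup>2 / f x \<partial>lborel) = 1 + (\<integral>x. (g x - f x)\<^sup>2 / f x \<partial>lborel)"
    unfolding eq using fi gi int by simp
  also have "(\<integral>x. (g x - f x)\<^sup>2 / f x \<partial>lborel) \<le> (\<integral>x. \<rho>\<^sup>2 * f x \<partial>lborel)"
    by (intro integral_mono int integrable_mult_right fi le)
  finally show "(\<integral>x. (g x)\<^sup>2 / f x \<partial>lborel) \<le> 1 + \<rho>\<^sup>2"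
    using fi by simp
qed

text \<open>For fixed \<open>u - v\<close> the right-hand side is at least \<open>F * G / (F + G) * (u - v)\<^sup>2\<close>. The left-hand side replaces this
  weight by a lower bound whose integral needs only the mass of \<open>G\<close> and the chi-square
  integral of \<open>G\<^sup>2 / F\<close>, both of which factorize over independent observations.\<close>

lemma weighted_squares_lower_bound:
  fixes F G u v t :: real
  assumes "F > 0" "G \<ge> 0"
  shows "(2 * t * G - t\<^sup>2 * (G + G\<^sup>2 / F)) * (u - v)\<^sup>2 \<le> F * u\<^sup>2 + G * v\<^sup>2"
proof -
  have s: "F + G > 0" using assms by simp
  have "F * G / (F + G) - (2 * t * G - t\<^sup>2 * (G + G\<^sup>2 / F)) = G * (F - t * (F + G))\<^sup>2 / (F * (F + G))"
    using assms s by (simp add: divide_simps) (simp add: algebra_simps power2_eq_square)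
  moreover have "\<dots> \<ge> 0" using assms by simp
  ultimately have "(2 * t * G - t\<^sup>2 * (G + G\<^sup>2 / F)) * (u - v)\<^sup>2 \<le> F * G / (F + G) * (u - v)\<^sup>2"
    by (intro mult_right_mono) auto
  also have "\<dots> = F * u\<^sup>2 + G * v\<^sup>2 - (F * u + G * v)\<^sup>2 / (F + G)"
    using s by (simp add: divide_simps) (simp add: algebra_simps power2_eq_square)
  also have "\<dots> \<le> F * u\<^sup>2 + G * v\<^sup>2" using s by simp
  finally show ?thesis .
qed

lemma integral_le_nn_integral:
  assumes "integrable M (h :: 'x \<Rightarrow> real)"
  shows "ennreal (\<integral>x. h x \<partial>M) \<le> (\<integral>\<^sup>+x. ennreal (h x) \<partial>M)"
proof -
  have "ennreal (\<integral>x. h x \<partial>M) \<le> ennreal (\<integral>x. max 0 (h x) \<partial>M)"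
    using assms by (intro ennreal_leI integral_mono) auto
  also have "\<dots> = (\<integral>\<^sup>+x. ennreal (max 0 (h x)) \<partial>M)"
    using assms by (intro nn_integral_eq_integral[symmetric]) auto
  also have "(\<lambda>x. ennreal (max 0 (h x))) = (\<lambda>x. ennreal (h x))"
    by (auto simp: max_def ennreal_neg fun_eq_iff)
  finally show ?thesis .
qed

text \<open>A statistic cannot be close to \<open>a\<close> under \<open>f\<close> and close to \<open>b\<close> under \<open>g\<close>: the chi-square integral of the
  product laws is at most \<open>(1 + \<rho>\<^sup>2) ^ n \<le> exp 1\<close>, so the two laws overlap substantially.\<close>

lemma two_point_lower_bound:
  fixes f g :: "'a::euclidean_space \<Rightarrow> real"
  assumes f: "f \<in> prob_densities" and g: "g \<in> prob_densities"
    and pos: "\<And>x. 0 < f x" and close: "\<And>x. \<bar>g x - f x\<bar> \<le> \<rho> * f x"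
    and \<rho>: "0 \<le> \<rho>" "real n * \<rho>\<^sup>2 \<le> 1"
    and T: "T \<in> borel_measurable (\<Pi>\<^sub>M i\<in>{..<n}. borel)"
  shows "ennreal ((a - b)\<^sup>2 / 4)
      \<le> (\<integral>\<^sup>+X. ennreal ((T X - a)\<^sup>2) \<partial>iid_law n f) + (\<integral>\<^sup>+X. ennreal ((T X - b)\<^sup>2) \<partial>iid_law n g)"
proof -
  interpret product_sigma_finite "\<lambda>_::nat. lborel :: 'a measure"
    by (intro product_sigma_finite.intro) (rule sigma_finite_lborel)
  let ?P = "\<Pi>\<^sub>M i\<in>{..<n}. (lborel :: 'a measure)"
  note [measurable] = prob_densityD(1)[OF f] prob_densityD(1)[OF g]
  have "sets ?P = sets (\<Pi>\<^sub>M i\<in>{..<n}. (borel :: 'a measure))" by (intro sets_PiM_cong) auto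
  from T measurable_cong_sets[OF this refl] have [measurable]: "T \<in> borel_measurable ?P" by blast
  define F where "F X = (\<Prod>i<n. f (X i))" for X
  define G where "G X = (\<Prod>i<n. g (X i))" for X
  have [measurable]: "F \<in> borel_measurable ?P" "G \<in> borel_measurable ?P"
    unfolding F_def G_def by measurable
  have F_pos: "F X > 0" for X unfolding F_def using pos by (intro prod_pos) auto
  have G_nonneg: "G X \<ge> 0" for X unfolding G_def using prob_densityD(2)[OF g] by (intro prod_nonneg) auto
  have GF: "(G X)\<^sup>2 / F X = (\<Prod>i<n. (g (X i))\<^sup>2 / f (X i))" for X
    by (simp add: F_def G_def prod_dividef prod_power_distrib)
  note chi = chi_square_close_densities[OF f g pos close \<rho>(1)]
  have G_int: "integrable ?P G"
    unfolding G_def by (intro product_integrable_prod prob_densityD(3)[OF g]) auto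
  have "(\<integral>X. G X \<partial>?P) = (\<Prod>i<n. \<integral>x. g x \<partial>lborel)"
    unfolding G_def by (intro product_integral_prod prob_densityD(3)[OF g]) auto
  then have G_integral: "(\<integral>X. G X \<partial>?P) = 1"
    by (simp add: prob_densityD(4)[OF g])
  have GF_int: "integrable ?P (\<lambda>X. (G X)\<^sup>2 / F X)"
    unfolding GF by (intro product_integrable_prod chi) auto
  have "(\<integral>X. (G X)\<^sup>2 / F X \<partial>?P) = (\<integral>x. (g x)\<^sup>2 / f x \<partial>lborel) ^ n"
    unfolding GF using chi(1) by (subst product_integral_prod) auto
  also have "\<dots> \<le> (1 + \<rho>\<^sup>2) ^ n"
    using chi(2) pos by (intro power_mono integral_nonneg_AE) (auto simp: less_imp_le)
  also have "\<dots> \<le> exp (\<rho>\<^sup>2) ^ n"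
    by (intro power_mono) auto
  also have "\<dots> = exp (real n * \<rho>\<^sup>2)"
    by (simp add: exp_of_nat_mult)
  also have "\<dots> \<le> exp 1" using \<rho>(2) by simp
  also have "exp 1 \<le> (3::real)" by (rule exp_le)
  finally have GF_le: "(\<integral>X. (G X)\<^sup>2 / F X \<partial>?P) \<le> 3" .
  \<comment> \<open>The parameter 1/4 is the optimal choice \<open>1 / (1 + V)\<close> for the bound \<open>V = 3\<close> on the chi-square integral.\<close>
  define h where "h X = (2 * (1 / 4) * G X - (1 / 4)\<^sup>2 * (G X + (G X)\<^sup>2 / F X)) * (a - b)\<^sup>2" for X
  have h_int: "integrable ?P h"
    unfolding h_def using G_int GF_int by auto
  have h_integral: "(\<integral>X. h X \<partial>?P) = (1 / 2 - 1 / 16 * (1 + (\<integral>X. (G X)\<^sup>2 / F X \<partial>?P))) * (a - b)\<^sup>2"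
    unfolding h_def using G_int G_integral GF_int by (simp add: power2_eq_square)
  have "(a - b)\<^sup>2 / 4 = (1 / 2 - 1 / 16 * (1 + 3)) * (a - b)\<^sup>2" by simp
  also have "\<dots> \<le> (\<integral>X. h X \<partial>?P)"
    unfolding h_integral using GF_le by (intro mult_right_mono) auto
  finally have "ennreal ((a - b)\<^sup>2 / 4) \<le> ennreal (\<integral>X. h X \<partial>?P)"
    by (rule ennreal_leI)
  also have "\<dots> \<le> (\<integral>\<^sup>+X. ennreal (h X) \<partial>?P)"
    by (rule integral_le_nn_integral[OF h_int])
  also have "\<dots> \<le> (\<integral>\<^sup>+X. ennreal (F X) * ennreal ((T X - a)\<^sup>2) + ennreal (G X) * ennreal ((T X - b)\<^sup>2) \<partial>?P)"
  proof (intro nn_integral_mono)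
    fix X
    have "h X \<le> F X * (T X - a)\<^sup>2 + G X * (T X - b)\<^sup>2"
      using weighted_squares_lower_bound[OF F_pos G_nonneg, of "1 / 4" X X "T X - a" "T X - b"]
      by (simp add: h_def power2_commute[of b a])
    then show "ennreal (h X) \<le> ennreal (F X) * ennreal ((T X - a)\<^sup>2) + ennreal (G X) * ennreal ((T X - b)\<^sup>2)"
      using F_pos[of X] G_nonneg[of X]
      by (simp add: ennreal_mult[symmetric] ennreal_plus[symmetric] ennreal_leI less_imp_le del: ennreal_plus)
  qed
  also have "\<dots> = (\<integral>\<^sup>+X. ennreal ((T X - a)\<^sup>2) \<partial>iid_law n f) + (\<integral>\<^sup>+X. ennreal ((T X - b)\<^sup>2) \<partial>iid_law n g)"
    unfolding iid_law_eq_density[OF f] iid_law_eq_density[OF g]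
    unfolding F_def[symmetric] G_def[symmetric]
    by (simp add: nn_integral_add nn_integral_density)
  finally show ?thesis .
qed

lemma sum_Pow_pairs:
  fixes h :: "'k set \<Rightarrow> 'b::comm_monoid_add"
  assumes "finite K" "k \<in> K"
  shows "(\<Sum>S\<in>Pow K. h S) = (\<Sum>S\<in>Pow (K - {k}). h S + h (insert k S))"
proof -
  have "Pow K = Pow (K - {k}) \<union> insert k ` Pow (K - {k})"
    using assms by (subst Pow_insert[symmetric]) (simp add: insert_absorb)
  moreover have "Pow (K - {k}) \<inter> insert k ` Pow (K - {k}) = {}" by auto
  moreover have "inj_on (insert k) (Pow (K - {k}))" by (auto simp: inj_on_def)
  ultimately show ?thesis
    using assms by (simp add: sum.union_disjoint sum.reindex sum.distrib)
qed

text \<open>Assouad's lemma in a form suited to L2 loss. The worst-case risk dominates the average over all vertices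
  \<open>S\<close> of the cube, and by Bessel's inequality the loss splits into one squared error per coordinate. For
  coordinate \<open>k\<close> the vertices are grouped into pairs \<open>S\<close>, \<open>insert k S\<close>; the two-point bound applies to each pair.
  Only the effect of \<open>k\<close> on its own functional \<open>\<psi> k\<close> enters, so the functionals may also react to the other
  coordinates.\<close>

lemma assouad_lower_bound:
  fixes f :: "'k set \<Rightarrow> 'a::euclidean_space \<Rightarrow> real" and F :: "('a \<Rightarrow> real) set"
  assumes K: "finite K"
    and mem: "\<And>S. S \<subseteq> K \<Longrightarrow> f S \<in> F"
    and dens: "\<And>S. S \<subseteq> K \<Longrightarrow> f S \<in> prob_densities" and fL2: "\<And>S. S \<subseteq> K \<Longrightarrow> f S \<in> L2"
    and pos: "\<And>S x. S \<subseteq> K \<Longrightarrow> 0 < f S x"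
    and close: "\<And>S k x. k \<in> K \<Longrightarrow> S \<subseteq> K - {k} \<Longrightarrow> \<bar>f (insert k S) x - f S x\<bar> \<le> \<rho> * f S x"
    and \<rho>: "0 \<le> \<rho>" "real n * \<rho>\<^sup>2 \<le> 1"
    and \<psi>: "\<And>k. k \<in> K \<Longrightarrow> \<psi> k \<in> L2"
    and bessel: "\<And>h. h \<in> L2 \<Longrightarrow> (\<Sum>k\<in>K. (\<integral>x. h x * \<psi> k x \<partial>lborel)\<^sup>2) \<le> B * (\<integral>x. (h x)\<^sup>2 \<partial>lborel)"
    and B: "B > 0"
    and sep: "\<And>S k. k \<in> K \<Longrightarrow> S \<subseteq> K - {k} \<Longrightarrow>
        \<Delta> \<le> \<bar>\<integral>x. (f (insert k S) x - f S x) * \<psi> k x \<partial>lborel\<bar>"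
    and \<Delta>: "\<Delta> \<ge> 0"
  shows "ennreal (real (card K) * \<Delta>\<^sup>2 / (8 * B)) \<le> minimax_risk n F"
  unfolding minimax_risk_def
proof (rule INF_greatest)
  fix est :: "(nat \<Rightarrow> 'a) \<Rightarrow> 'a \<Rightarrow> real"
  assume est: "est \<in> estimators n"
  define R where "R = (SUP f\<in>F. \<integral>\<^sup>+X. l2_loss (est X) f \<partial>iid_law n f)"
  define T where "T k X = (\<integral>x. est X x * \<psi> k x \<partial>lborel)" for k X
  define a where "a k S = (\<integral>x. f S x * \<psi> k x \<partial>lborel)" for k S
  have T_meas: "T k \<in> borel_measurable (\<Pi>\<^sub>M i\<in>{..<n}. borel)" if "k \<in> K" for k
  proof -
    have [measurable]: "\<psi> k \<in> borel_measurable borel" using \<psi>[OF that] by (simp add: L2_def)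
    have [measurable]: "case_prod est \<in> borel_measurable ((\<Pi>\<^sub>M i\<in>{..<n}. borel) \<Otimes>\<^sub>M borel)"
      using est by (simp add: estimators_def)
    show ?thesis unfolding T_def by measurable
  qed
  have T_meas' [measurable]: "T k \<in> borel_measurable (iid_law n (f S))" if "k \<in> K" for k S
    using T_meas[OF that] measurable_cong_sets[OF sets_iid_law refl] by blast
  have loss: "(\<Sum>k\<in>K. ennreal ((T k X - a k S)\<^sup>2)) \<le> ennreal B * l2_loss (est X) (f S)"
    if S: "S \<subseteq> K" for X S
  proof (cases "est X \<in> L2")
    case True
    note d = L2_diff[OF True fL2[OF S]]
    have eq: "T k X - a k S = (\<integral>x. (est X x - f S x) * \<psi> k x \<partial>lborel)" if "k \<in> K" for k
      unfolding T_def a_def left_diff_distrib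
      by (intro Bochner_Integration.integral_diff[symmetric] L2_mult_integrable True fL2 S \<psi> that)
    have "(\<Sum>k\<in>K. ennreal ((T k X - a k S)\<^sup>2)) = ennreal (\<Sum>k\<in>K. (T k X - a k S)\<^sup>2)"
      by simp
    also have "\<dots> \<le> ennreal (B * (\<integral>x. (est X x - f S x)\<^sup>2 \<partial>lborel))"
      using bessel[OF d] by (intro ennreal_leI) (simp add: eq)
    also have "\<dots> = ennreal B * (\<integral>\<^sup>+x. ennreal ((est X x - f S x)\<^sup>2) \<partial>lborel)"
      using d B by (simp add: ennreal_mult nn_integral_eq_integral L2_def)
    finally show ?thesis using True by (simp add: l2_loss_def)
  next
    case False
    then show ?thesis using B by (simp add: l2_loss_def ennreal_mult_top)
  qed
  have pair: "ennreal (\<Delta>\<^sup>2 / 4)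
      \<le> (\<integral>\<^sup>+X. ennreal ((T k X - a k S)\<^sup>2) \<partial>iid_law n (f S))
        + (\<integral>\<^sup>+X. ennreal ((T k X - a k (insert k S))\<^sup>2) \<partial>iid_law n (f (insert k S)))"
    if k: "k \<in> K" and S: "S \<subseteq> K - {k}" for k S
  proof -
    have S': "S \<subseteq> K" "insert k S \<subseteq> K" using k S by auto
    have "a k (insert k S) - a k S = (\<integral>x. (f (insert k S) x - f S x) * \<psi> k x \<partial>lborel)"
      unfolding a_def left_diff_distrib
      by (intro Bochner_Integration.integral_diff[symmetric] L2_mult_integrable fL2 S' \<psi> k)
    with sep[OF k S] have "\<Delta> \<le> \<bar>a k S - a k (insert k S)\<bar>" by simp
    then have "\<Delta>\<^sup>2 \<le> (a k S - a k (insert k S))\<^sup>2"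
      using power_mono[OF _ \<Delta>, of _ 2] by fastforce
    then have "ennreal (\<Delta>\<^sup>2 / 4) \<le> ennreal ((a k S - a k (insert k S))\<^sup>2 / 4)"
      by (intro ennreal_leI) simp
    also have "\<dots> \<le> (\<integral>\<^sup>+X. ennreal ((T k X - a k S)\<^sup>2) \<partial>iid_law n (f S))
        + (\<integral>\<^sup>+X. ennreal ((T k X - a k (insert k S))\<^sup>2) \<partial>iid_law n (f (insert k S)))"
      by (rule two_point_lower_bound[OF dens[OF S'(1)] dens[OF S'(2)] pos[OF S'(1)] close[OF k S] \<rho> T_meas[OF k]])
    finally show ?thesis .
  qed
  have cardP: "card (Pow (K - {k})) * 2 = card (Pow K)" if "k \<in> K" for k
  proof -
    have "card K = Suc (card (K - {k}))" using that K by (intro card.remove)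
    then show ?thesis using K by (simp add: card_Pow)
  qed
  have "ennreal (real (card (Pow K)) * (real (card K) * \<Delta>\<^sup>2 / 8))
      = (\<Sum>k\<in>K. ennreal (real (card (Pow K)) / 2 * (\<Delta>\<^sup>2 / 4)))"
    by (subst sum_ennreal) (auto simp: field_simps)
  also have "\<dots> = (\<Sum>k\<in>K. \<Sum>S\<in>Pow (K - {k}). ennreal (\<Delta>\<^sup>2 / 4))"
  proof (intro sum.cong refl)
    fix k assume "k \<in> K"
    then have "real (card (Pow K)) / 2 = real (card (Pow (K - {k})))"
      using cardP[of k] by linarith
    then show "ennreal (real (card (Pow K)) / 2 * (\<Delta>\<^sup>2 / 4)) = (\<Sum>S\<in>Pow (K - {k}). ennreal (\<Delta>\<^sup>2 / 4))"
      by (subst sum_ennreal) auto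
  qed
  also have "\<dots> \<le> (\<Sum>k\<in>K. \<Sum>S\<in>Pow (K - {k}).
      (\<integral>\<^sup>+X. ennreal ((T k X - a k S)\<^sup>2) \<partial>iid_law n (f S))
        + (\<integral>\<^sup>+X. ennreal ((T k X - a k (insert k S))\<^sup>2) \<partial>iid_law n (f (insert k S))))"
    by (intro sum_mono pair) auto
  also have "\<dots> = (\<Sum>k\<in>K. \<Sum>S\<in>Pow K. \<integral>\<^sup>+X. ennreal ((T k X - a k S)\<^sup>2) \<partial>iid_law n (f S))"
    using K by (intro sum.cong refl sum_Pow_pairs[symmetric])
  also have "\<dots> = (\<Sum>S\<in>Pow K. \<integral>\<^sup>+X. (\<Sum>k\<in>K. ennreal ((T k X - a k S)\<^sup>2)) \<partial>iid_law n (f S))"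
    by (subst sum.swap) (intro sum.cong refl nn_integral_sum[symmetric], measurable)
  also have "\<dots> \<le> (\<Sum>S\<in>Pow K. ennreal B * R)"
  proof (intro sum_mono)
    fix S assume "S \<in> Pow K"
    then have S: "S \<subseteq> K" by simp
    \<comment> \<open>The factor \<open>B\<close> is moved to the measurable side, because the loss as a function of the sample
      is not known to be measurable.\<close>
    have "(\<integral>\<^sup>+X. (\<Sum>k\<in>K. ennreal ((T k X - a k S)\<^sup>2)) \<partial>iid_law n (f S)) / ennreal B
        = (\<integral>\<^sup>+X. (\<Sum>k\<in>K. ennreal ((T k X - a k S)\<^sup>2)) / ennreal B \<partial>iid_law n (f S))"
      by (subst nn_integral_divide) (auto intro!: borel_measurable_sum)
    also have "\<dots> \<le> (\<integral>\<^sup>+X. l2_loss (est X) (f S) \<partial>iid_law n (f S))"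
      using loss[OF S] B by (intro nn_integral_mono) (simp add: divide_le_posI_ennreal mult.commute)
    also have "\<dots> \<le> R"
      unfolding R_def using mem[OF S] by (intro SUP_upper)
    finally have "ennreal B * ((\<integral>\<^sup>+X. (\<Sum>k\<in>K. ennreal ((T k X - a k S)\<^sup>2)) \<partial>iid_law n (f S)) / ennreal B)
        \<le> ennreal B * R"
      by (rule mult_left_mono) simp
    then show "(\<integral>\<^sup>+X. (\<Sum>k\<in>K. ennreal ((T k X - a k S)\<^sup>2)) \<partial>iid_law n (f S)) \<le> ennreal B * R"
      using B by (simp add: ennreal_times_divide mult.commute[of "ennreal B" "nn_integral _ _"] ennreal_mult_divide_eq)
  qed
  also have "\<dots> = ennreal (real (card (Pow K)) * B) * R"
    using B by (simp add: ennreal_mult ennreal_of_nat_eq_real_of_nat mult.assoc)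
  finally have main: "ennreal (real (card (Pow K)) * (real (card K) * \<Delta>\<^sup>2 / 8)) \<le> ennreal (real (card (Pow K)) * B) * R" .
  show "ennreal (real (card K) * \<Delta>\<^sup>2 / (8 * B)) \<le> R"
  proof (cases R)
    case (real r)
    have c: "real (card (Pow K)) > 0" using K by (simp add: card_Pow)
    from main have "real (card (Pow K)) * (real (card K) * \<Delta>\<^sup>2 / 8) \<le> real (card (Pow K)) * B * r"
      using real B by (simp add: ennreal_mult[symmetric])
    then have "real (card K) * \<Delta>\<^sup>2 / 8 \<le> B * r"
      using c by (simp add: mult.assoc)
    then show ?thesis
      using real B by (auto intro!: ennreal_leI simp: field_simps)
  qed simp
qed

section \<open>Smoothing by a probability measure\<close>

definition convolve :: "'a::euclidean_space measure \<Rightarrow> ('a \<Rightarrow> real) \<Rightarrow> 'a \<Rightarrow> real" where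
  "convolve \<eta> w x = (\<integral>y. w (x - y) \<partial>\<eta>)"

lemma borel_prob_measurable:
  assumes "borel_prob \<eta>"
  shows "f \<in> borel_measurable \<eta> \<longleftrightarrow> f \<in> borel_measurable borel"
  using assms by (simp add: borel_prob_def cong: measurable_cong_sets)

lemma integrable_bounded_prob:
  fixes f :: "'a::euclidean_space \<Rightarrow> 'b::{banach, second_countable_topology}"
  assumes "borel_prob \<eta>" "f \<in> borel_measurable borel" "\<And>y. norm (f y) \<le> B"
  shows "integrable \<eta> f"
proof -
  interpret prob_space \<eta> using assms(1) by (simp add: borel_prob_def)
  have "f \<in> borel_measurable \<eta>"
    using assms(1,2) by (simp add: borel_prob_def cong: measurable_cong_sets)
  then show ?thesis by (rule integrable_const_bound[of _ B, rotated]) (simp add: assms(3))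
qed

lemma convolve_measurable:
  assumes "borel_prob \<eta>" "w \<in> borel_measurable borel"
  shows "convolve \<eta> w \<in> borel_measurable borel"
proof -
  interpret prob_space \<eta> using assms(1) by (simp add: borel_prob_def)
  have [measurable_cong]: "sets \<eta> = sets borel" using assms(1) by (simp add: borel_prob_def)
  note assms(2)[measurable]
  show ?thesis unfolding convolve_def by measurable
qed

lemma convolve_bound:
  assumes "borel_prob \<eta>" "w \<in> borel_measurable borel" "\<And>y. \<bar>w y\<bar> \<le> B"
  shows "\<bar>convolve \<eta> w x\<bar> \<le> B"
proof -
  interpret prob_space \<eta> using assms(1) by (simp add: borel_prob_def)
  have "integrable \<eta> (\<lambda>y. w (x - y))"
    by (rule integrable_bounded_prob[OF assms(1), where B=B]) (use assms in auto)
  then have "(\<integral>y. norm (w (x - y)) \<partial>\<eta>) \<le> (\<integral>y. B \<partial>\<eta>)"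
    by (intro integral_mono integrable_norm) (use assms(3) in auto)
  with Bochner_Integration.integral_norm_bound[of \<eta> "\<lambda>y. w (x - y)"]
  have "norm (\<integral>y. w (x - y) \<partial>\<eta>) \<le> (\<integral>y. B \<partial>\<eta>)" by (rule order_trans)
  then show ?thesis by (simp add: convolve_def prob_space)
qed

lemma convolve_mono:
  assumes "borel_prob \<eta>" "v \<in> borel_measurable borel" "w \<in> borel_measurable borel"
    "\<And>y. \<bar>v y\<bar> \<le> B" "\<And>y. \<bar>w y\<bar> \<le> B" "\<And>y. v y \<le> w y"
  shows "convolve \<eta> v x \<le> convolve \<eta> w x"
  unfolding convolve_def
  by (intro integral_mono integrable_bounded_prob[OF assms(1), where B=B]) (use assms in auto)

lemma convolve_prob_density:
  fixes w :: "'a::euclidean_space \<Rightarrow> real"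
  assumes \<eta>: "borel_prob \<eta>" and w: "w \<in> prob_densities" and B: "\<And>y. w y \<le> B"
  shows "convolve \<eta> w \<in> prob_densities"
proof -
  interpret P: prob_space \<eta> using assms(1) by (simp add: borel_prob_def)
  interpret pair_sigma_finite lborel \<eta> ..
  have [measurable_cong]: "sets \<eta> = sets borel" using assms(1) by (simp add: borel_prob_def)
  note [measurable] = prob_densityD(1)[OF w]
  have nn: "0 \<le> w x" for x by (rule prob_densityD(2)[OF w])
  have int: "integrable \<eta> (\<lambda>y. w (x - y))" for x
    by (rule integrable_bounded_prob[OF \<eta>, where B=B]) (auto simp: nn B)
  have shift: "(\<integral>\<^sup>+x. ennreal (w (x - y)) \<partial>lborel) = 1" for y
    using lborel_integrable_translate[OF prob_densityD(3)[OF w], of y]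
      lborel_integral_translate[OF prob_densityD(1)[OF w], of y] prob_densityD(4)[OF w]
    by (simp add: nn_integral_eq_integral nn)
  have "(\<integral>\<^sup>+x. ennreal (convolve \<eta> w x) \<partial>lborel) = (\<integral>\<^sup>+x. \<integral>\<^sup>+y. ennreal (w (x - y)) \<partial>\<eta> \<partial>lborel)"
    unfolding convolve_def by (intro nn_integral_cong nn_integral_eq_integral[symmetric] int) (simp add: nn)
  also have "\<dots> = (\<integral>\<^sup>+y. \<integral>\<^sup>+x. ennreal (w (x - y)) \<partial>lborel \<partial>\<eta>)"
    by (rule Fubini'[symmetric]) measurable
  also have "\<dots> = 1"
    by (simp add: shift P.emeasure_space_1)
  finally show ?thesis
    using convolve_measurable[OF \<eta> prob_densityD(1)[OF w]] nn
    by (auto simp: prob_densities_def convolve_def intro!: integral_nonneg_AE)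
qed

lemma convolve_L2:
  assumes "borel_prob \<eta>" "w \<in> prob_densities" "\<And>y. w y \<le> B"
  shows "convolve \<eta> w \<in> L2"
proof -
  note d = prob_densityD[OF convolve_prob_density[OF assms]]
  have b: "convolve \<eta> w x \<le> B" for x
    using convolve_bound[OF assms(1) prob_densityD(1)[OF assms(2)], of B x]
      prob_densityD(2)[OF assms(2)] assms(3) by (simp add: abs_of_nonneg)
  have "integrable lborel (\<lambda>x. (convolve \<eta> w x)\<^sup>2)"
  proof (rule Bochner_Integration.integrable_bound[OF integrable_mult_right[OF d(3), of B]])
    have "(convolve \<eta> w x)\<^sup>2 \<le> B * convolve \<eta> w x" for x
      using mult_right_mono[OF b d(2)] by (simp add: power2_eq_square)
    then show "AE x in lborel. norm ((convolve \<eta> w x)\<^sup>2) \<le> norm (B * convolve \<eta> w x)"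
      by (auto intro: order_trans[OF _ abs_ge_self])
  qed (use d(1) in measurable)
  then show ?thesis using d(1) by (simp add: L2_def)
qed

section \<open>The effect of smoothing on a single wave\<close>

text \<open>Averaging a wave over shifts multiplies it by a complex number, whose modulus is the new amplitude and
  whose argument is the phase shift.\<close>

lemma sine_averaged_phase:
  fixes \<eta> :: "'a::euclidean_space measure"
  assumes \<eta>: "borel_prob \<eta>"
  shows "\<exists>\<beta>. \<forall>z. (\<integral>y. sin (z - k \<bullet> y) \<partial>\<eta>) = cmod (\<integral>y. cis (- (k \<bullet> y)) \<partial>\<eta>) * sin (z + \<beta>)"
proof -
  let ?E = "\<integral>y. cis (- (k \<bullet> y)) \<partial>\<eta>"
  have m: "(\<lambda>y. cis (z - k \<bullet> y)) \<in> borel_measurable borel" for z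
    unfolding cis_conv_exp by measurable
  have int: "integrable \<eta> (\<lambda>y. cis (z - k \<bullet> y))" for z
    by (rule integrable_bounded_prob[OF \<eta> m, where B=1]) simp
  have "(\<integral>y. sin (z - k \<bullet> y) \<partial>\<eta>) = cmod ?E * sin (z + Arg ?E)" for z
  proof -
    have "(\<integral>y. sin (z - k \<bullet> y) \<partial>\<eta>) = Im (\<integral>y. cis (z - k \<bullet> y) \<partial>\<eta>)"
      using integral_Im[OF int[of z]] by simp
    also have "(\<lambda>y. cis (z - k \<bullet> y)) = (\<lambda>y. cis z * cis (- (k \<bullet> y)))"
      by (simp add: cis_mult)
    also have "(\<integral>y. cis z * cis (- (k \<bullet> y)) \<partial>\<eta>) = cis z * ?E"
      by simp
    also have "?E = rcis (cmod ?E) (Arg ?E)"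
      by (simp add: rcis_cmod_Arg)
    also have "Im (cis z * rcis (cmod ?E) (Arg ?E)) = cmod ?E * sin (z + Arg ?E)"
      by (simp add: rcis_def sin_add algebra_simps)
    finally show ?thesis .
  qed
  then show ?thesis by blast
qed

lemma norm_cube_le:
  fixes x :: "'a::euclidean_space"
  assumes "\<delta> > 0" "x \<in> cube \<delta>"
  shows "\<delta> * norm x \<le> sqrt (real DIM('a)) * pi"
proof -
  have "(\<delta> * norm x)\<^sup>2 = (\<Sum>b\<in>Basis. (\<delta> * (x \<bullet> b))\<^sup>2)"
    unfolding power_mult_distrib power2_norm_eq_inner euclidean_inner[of x x]
    by (simp add: sum_distrib_left power2_eq_square)
  also have "\<dots> \<le> (\<Sum>b\<in>(Basis :: 'a set). pi\<^sup>2)"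
  proof (intro sum_mono)
    fix b :: 'a assume "b \<in> Basis"
    then have "\<bar>x \<bullet> b\<bar> \<le> pi / \<delta>"
      using assms(2) by (auto simp: mem_cube_iff abs_le_iff)
    then have "\<bar>\<delta> * (x \<bullet> b)\<bar> \<le> pi"
      using assms(1) by (simp add: abs_mult field_simps)
    then show "(\<delta> * (x \<bullet> b))\<^sup>2 \<le> pi\<^sup>2"
      by (metis abs_ge_zero power2_abs power_mono)
  qed
  also have "\<dots> = (sqrt (real DIM('a)) * pi)\<^sup>2"
    by (simp add: power_mult_distrib)
  finally show ?thesis
    by (rule power2_le_imp_le) simp
qed

lemma gaussian_ratio:
  "gaussian s (x - y) / gaussian s x = exp (s * (x \<bullet> y) - s * (norm y)\<^sup>2 / 2)" if "s > 0"
proof -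
  have "- s * (norm (x - y))\<^sup>2 / 2 - - s * (norm x)\<^sup>2 / 2 = s * (x \<bullet> y) - s * (norm y)\<^sup>2 / 2"
    unfolding power2_norm_eq_inner
    by (simp add: inner_diff_left inner_diff_right inner_commute algebra_simps) (simp add: field_simps)
  moreover have "gaussian s (x - y) / gaussian s x = exp (- s * (norm (x - y))\<^sup>2 / 2 - - s * (norm x)\<^sup>2 / 2)"
    unfolding exp_diff using that by (simp add: gaussian_def)
  ultimately show ?thesis by simp
qed

lemma abs_exp_minus_one_le:
  fixes t C :: real
  assumes "t \<le> C" "0 \<le> C"
  shows "\<bar>exp t - 1\<bar> \<le> exp C * min 1 \<bar>t\<bar>"
proof (cases "t \<le> 0")
  case True
  have "1 - exp t \<le> - t" using exp_ge_add_one_self[of t] by linarith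
  then have "1 - exp t \<le> min 1 \<bar>t\<bar>" using True by auto
  also have "\<dots> \<le> exp C * min 1 \<bar>t\<bar>" using assms(2) by (simp add: mult_le_cancel_right1)
  finally show ?thesis using True by simp
next
  case False
  have "exp t - 1 = exp t * (1 - exp (- t))" by (simp add: algebra_simps exp_minus_inverse)
  also have "\<dots> \<le> exp C * min 1 \<bar>t\<bar>"
  proof (intro mult_mono)
    have "1 - exp (- t) \<le> t" using exp_ge_add_one_self[of "- t"] by linarith
    then show "1 - exp (- t) \<le> min 1 \<bar>t\<bar>" by auto
  qed (use False assms(1) in auto)
  finally show ?thesis using False by simp
qed

text \<open>A wide Gaussian hardly changes under the shifts that a fixed probability measure \<open>\<eta>\<close> performs. The cube grows
  along with the width \<open>1 / \<delta>\<close>, so \<open>\<delta> * norm x\<close> stays bounded by a constant \<open>D\<close> on it, and the deviation of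
  the ratio from 1 is dominated, uniformly in \<open>x\<close>, by a bounded function of \<open>y\<close> that tends to 0 with \<open>\<delta>\<close>.
  Dominated convergence finishes the argument.\<close>

lemma slowly_varying_gaussian:
  fixes \<eta> :: "'a::euclidean_space measure"
  assumes \<eta>: "borel_prob \<eta>" and c: "c > 0" and \<delta>0: "\<delta>0 > 0"
  shows "\<exists>\<delta>. 0 < \<delta> \<and> \<delta> < \<delta>0 \<and> (\<forall>x\<in>cube \<delta>.
      integrable \<eta> (\<lambda>y. \<bar>gaussian (\<delta>\<^sup>2) (x - y) / gaussian (\<delta>\<^sup>2) x - 1\<bar>) \<and>
      (\<integral>y. \<bar>gaussian (\<delta>\<^sup>2) (x - y) / gaussian (\<delta>\<^sup>2) x - 1\<bar> \<partial>\<eta>) \<le> c)"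
proof -
  interpret prob_space \<eta> using \<eta> by (simp add: borel_prob_def)
  define D where "D = sqrt (real DIM('a)) * pi"
  have D: "D \<ge> 0" by (simp add: D_def)
  define \<delta> where "\<delta> j = min 1 \<delta>0 / (real j + 2)" for j :: nat
  have \<delta>: "0 < \<delta> j" "\<delta> j < \<delta>0" "\<delta> j \<le> 1" for j
  proof -
    have m: "min 1 \<delta>0 > 0" using \<delta>0 by simp
    then have "\<delta> j \<le> min 1 \<delta>0 / 2" unfolding \<delta>_def by (intro divide_left_mono) auto
    then show "\<delta> j < \<delta>0" "\<delta> j \<le> 1" using m \<delta>0 by linarith+
    show "0 < \<delta> j" unfolding \<delta>_def using m by (intro divide_pos_pos) auto
  qed
  define h where "h j y = exp (D\<^sup>2 / 2) * min 1 (\<delta> j * (D * norm y + (norm y)\<^sup>2 / 2))" for j and y :: 'a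
  have h_nn: "0 \<le> h j y" and h_le: "h j y \<le> exp (D\<^sup>2 / 2)" for j y
    using \<delta>(1)[of j] D by (auto simp: h_def)
  have h_meas: "h j \<in> borel_measurable borel" for j
    unfolding h_def by measurable
  have h_int: "integrable \<eta> (h j)" for j
    by (rule integrable_bounded_prob[OF \<eta> h_meas, of _ "exp (D\<^sup>2 / 2)"]) (simp add: h_nn h_le)
  have \<delta>_lim: "\<delta> \<longlonglongrightarrow> 0"
    unfolding \<delta>_def
    using LIMSEQ_ignore_initial_segment[OF lim_const_over_n[of "min 1 \<delta>0"], of 2]
    by (simp add: add.commute)
  have "(\<lambda>j. \<integral>y. h j y \<partial>\<eta>) \<longlonglongrightarrow> (\<integral>y. 0 \<partial>\<eta>)"
  proof (rule integral_dominated_convergence[where w="\<lambda>_. exp (D\<^sup>2 / 2)"])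
    show "AE y in \<eta>. (\<lambda>j. h j y) \<longlonglongrightarrow> 0"
    proof (rule AE_I2)
      fix y :: 'a
      have "(\<lambda>j. exp (D\<^sup>2 / 2) * min 1 (\<delta> j * (D * norm y + (norm y)\<^sup>2 / 2))) \<longlonglongrightarrow>
          exp (D\<^sup>2 / 2) * min 1 (0 * (D * norm y + (norm y)\<^sup>2 / 2))"
        by (intro tendsto_intros \<delta>_lim)
      then show "(\<lambda>j. h j y) \<longlonglongrightarrow> 0" by (simp add: h_def)
    qed
  qed (use h_meas borel_prob_measurable[OF \<eta>] h_nn h_le in auto)
  then have "eventually (\<lambda>j. (\<integral>y. h j y \<partial>\<eta>) < c) sequentially"
    using c by (intro order_tendstoD(2)) auto
  then obtain j where j: "(\<integral>y. h j y \<partial>\<eta>) < c"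
    by (auto simp: eventually_sequentially)
  have main: "\<bar>gaussian ((\<delta> j)\<^sup>2) (x - y) / gaussian ((\<delta> j)\<^sup>2) x - 1\<bar> \<le> h j y" if x: "x \<in> cube (\<delta> j)" for x y :: 'a
  proof -
    define t where "t = (\<delta> j)\<^sup>2 * (x \<bullet> y) - (\<delta> j)\<^sup>2 * (norm y)\<^sup>2 / 2"
    have nx: "\<delta> j * norm x \<le> D" unfolding D_def by (rule norm_cube_le[OF \<delta>(1) x])
    have xy: "\<bar>(\<delta> j)\<^sup>2 * (x \<bullet> y)\<bar> \<le> D * (\<delta> j * norm y)"
    proof -
      have "\<bar>(\<delta> j)\<^sup>2 * (x \<bullet> y)\<bar> \<le> (\<delta> j)\<^sup>2 * (norm x * norm y)"
        using Cauchy_Schwarz_ineq2[of x y] by (simp add: abs_mult mult_left_mono)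
      also have "\<dots> = (\<delta> j * norm x) * (\<delta> j * norm y)" by (simp add: power2_eq_square)
      also have "\<dots> \<le> D * (\<delta> j * norm y)"
        using nx \<delta>(1)[of j] by (intro mult_right_mono) auto
      finally show ?thesis .
    qed
    have "0 \<le> (D - \<delta> j * norm y)\<^sup>2" by simp
    then have t_le: "t \<le> D\<^sup>2 / 2"
      using xy by (simp add: t_def power2_diff power_mult_distrib)
    have "(\<delta> j)\<^sup>2 * (norm y)\<^sup>2 / 2 \<le> \<delta> j * ((norm y)\<^sup>2 / 2)"
      using \<delta>(1,3)[of j] by (simp add: power2_eq_square mult_left_le_one_le mult.assoc mult_le_cancel_left2)
    moreover have "\<bar>t\<bar> \<le> \<bar>(\<delta> j)\<^sup>2 * (x \<bullet> y)\<bar> + \<bar>(\<delta> j)\<^sup>2 * (norm y)\<^sup>2 / 2\<bar>"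
      unfolding t_def by (rule abs_triangle_ineq4)
    ultimately have t_abs: "\<bar>t\<bar> \<le> \<delta> j * (D * norm y + (norm y)\<^sup>2 / 2)"
      using xy by (simp add: algebra_simps)
    have "\<bar>exp t - 1\<bar> \<le> exp (D\<^sup>2 / 2) * min 1 \<bar>t\<bar>"
      by (rule abs_exp_minus_one_le[OF t_le]) simp
    also have "\<dots> \<le> h j y"
      unfolding h_def using t_abs by (intro mult_left_mono) auto
    finally show ?thesis
      unfolding t_def using \<delta>(1)[of j] by (simp add: gaussian_ratio)
  qed
  have "integrable \<eta> (\<lambda>y. \<bar>gaussian ((\<delta> j)\<^sup>2) (x - y) / gaussian ((\<delta> j)\<^sup>2) x - 1\<bar>) \<and>
      (\<integral>y. \<bar>gaussian ((\<delta> j)\<^sup>2) (x - y) / gaussian ((\<delta> j)\<^sup>2) x - 1\<bar> \<partial>\<eta>) \<le> c" if x: "x \<in> cube (\<delta> j)" for x :: 'a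
  proof
    show i: "integrable \<eta> (\<lambda>y. \<bar>gaussian ((\<delta> j)\<^sup>2) (x - y) / gaussian ((\<delta> j)\<^sup>2) x - 1\<bar>)"
      using order_trans[OF main[OF x] h_le]
      by (intro integrable_bounded_prob[OF \<eta>, where B="exp (D\<^sup>2 / 2)"]) auto
    have "(\<integral>y. \<bar>gaussian ((\<delta> j)\<^sup>2) (x - y) / gaussian ((\<delta> j)\<^sup>2) x - 1\<bar> \<partial>\<eta>) \<le> (\<integral>y. h j y \<partial>\<eta>)"
      by (intro integral_mono i h_int main[OF x])
    with j show "(\<integral>y. \<bar>gaussian ((\<delta> j)\<^sup>2) (x - y) / gaussian ((\<delta> j)\<^sup>2) x - 1\<bar> \<partial>\<eta>) \<le> c" by simp
  qed
  with \<delta>(1,2)[of j] show ?thesis by blast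
qed

text \<open>Relative to the envelope \<open>p\<close>, the smoothed wave is a wave of amplitude at least \<open>r0\<close> with phase \<open>\<beta>\<close>, up to an
  error of at most \<open>r0 / 4\<close>. Testing against that same wave gives half of the amplitude per unit volume, so
  a quarter survives. The error bound holds uniformly in the frequency \<open>m\<close>.\<close>

lemma smoothed_sine_separation:
  fixes \<eta> :: "'a::euclidean_space measure" and m :: "'a \<Rightarrow> int"
  assumes \<eta>: "borel_prob \<eta>" and \<delta>: "\<delta> > 0" and m: "\<And>b. b \<in> Basis \<Longrightarrow> m b > 0"
  defines "k \<equiv> lattice_point \<delta> m" and "p \<equiv> gaussian (\<delta>\<^sup>2)"
  assumes r0: "r0 \<le> cmod (\<integral>y. cis (- (k \<bullet> y)) \<partial>\<eta>)"
    and close: "\<And>x. x \<in> cube \<delta> \<Longrightarrow> integrable \<eta> (\<lambda>y. \<bar>p (x - y) / p x - 1\<bar>) \<and>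
        (\<integral>y. \<bar>p (x - y) / p x - 1\<bar> \<partial>\<eta>) \<le> r0 / 4"
    and \<beta>: "\<And>z. (\<integral>y. sin (z - k \<bullet> y) \<partial>\<eta>) = cmod (\<integral>y. cis (- (k \<bullet> y)) \<partial>\<eta>) * sin (z + \<beta>)"
  shows "r0 / 4 * measure lborel (cube \<delta> :: 'a set)
    \<le> (\<integral>x. convolve \<eta> (\<lambda>x. p x * sin (k \<bullet> x)) x * (indicator (cube \<delta>) x * sin (k \<bullet> x + \<beta>) / p x) \<partial>lborel)"
proof -
  define r where "r = cmod (\<integral>y. cis (- (k \<bullet> y)) \<partial>\<eta>)"
  define err where "err x = convolve \<eta> (\<lambda>x. p x * sin (k \<bullet> x)) x / p x - r * sin (k \<bullet> x + \<beta>)" for x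
  have p_pos: "p x > 0" for x using \<delta> by (simp add: p_def gaussian_pos)
  have [measurable]: "p \<in> borel_measurable borel" by (simp add: p_def)
  have conv_meas [measurable]: "convolve \<eta> (\<lambda>x. p x * sin (k \<bullet> x)) \<in> borel_measurable borel"
    by (intro convolve_measurable[OF \<eta>]) measurable
  have sin_int: "integrable \<eta> (\<lambda>y. sin (k \<bullet> x - k \<bullet> y))" for x
    by (rule integrable_bounded_prob[OF \<eta>, where B=1]) auto
  have err: "\<bar>err x\<bar> \<le> r0 / 4" if x: "x \<in> cube \<delta>" for x
  proof -
    note cl = close[OF x, THEN conjunct1] close[OF x, THEN conjunct2]
    have int: "integrable \<eta> (\<lambda>y. (p (x - y) / p x - 1) * sin (k \<bullet> x - k \<bullet> y))"
    proof (rule Bochner_Integration.integrable_bound[OF cl(1)])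
      show "(\<lambda>y. (p (x - y) / p x - 1) * sin (k \<bullet> x - k \<bullet> y)) \<in> borel_measurable \<eta>"
        unfolding borel_prob_measurable[OF \<eta>] by measurable
    qed (auto simp: abs_mult mult_left_le)
    have "err x = (\<integral>y. (p (x - y) / p x - 1) * sin (k \<bullet> x - k \<bullet> y) \<partial>\<eta>)"
    proof -
      have "convolve \<eta> (\<lambda>x. p x * sin (k \<bullet> x)) x / p x
          = (\<integral>y. (p (x - y) / p x - 1) * sin (k \<bullet> x - k \<bullet> y) + sin (k \<bullet> x - k \<bullet> y) \<partial>\<eta>)"
        unfolding convolve_def integral_divide_zero[symmetric]
        by (intro Bochner_Integration.integral_cong refl) (simp add: inner_diff_right algebra_simps)
      then show ?thesis
        using int sin_int[of x] \<beta>[of "k \<bullet> x"] by (simp add: err_def r_def)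
    qed
    also have "\<bar>\<dots>\<bar> \<le> (\<integral>y. norm ((p (x - y) / p x - 1) * sin (k \<bullet> x - k \<bullet> y)) \<partial>\<eta>)"
      using Bochner_Integration.integral_norm_bound[of \<eta> "\<lambda>y. (p (x - y) / p x - 1) * sin (k \<bullet> x - k \<bullet> y)"]
      by simp
    also have "\<dots> \<le> (\<integral>y. \<bar>p (x - y) / p x - 1\<bar> \<partial>\<eta>)"
      by (intro integral_mono integrable_norm int cl(1)) (auto simp: abs_mult mult_left_le)
    finally show ?thesis using cl(2) by linarith
  qed
  let ?J = "\<lambda>x. indicator (cube \<delta>) x * (sin (k \<bullet> x + \<beta>) * (r * sin (k \<bullet> x + \<beta>) + err x))"
  have [measurable]: "err \<in> borel_measurable borel" unfolding err_def by measurable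
  have r: "r \<ge> 0" by (simp add: r_def)
  have J_int: "integrable lborel ?J"
  proof (rule integrable_on_cube[where B="r + r0 / 4"])
    fix x :: 'a assume x: "x \<in> cube \<delta>"
    have "\<bar>sin (k \<bullet> x + \<beta>)\<bar> * \<bar>r * sin (k \<bullet> x + \<beta>) + err x\<bar> \<le> 1 * (r * 1 + r0 / 4)"
      using err[OF x] r
      by (intro mult_mono order_trans[OF abs_triangle_ineq] add_mono) (auto simp: abs_mult mult_left_le)
    then show "\<bar>sin (k \<bullet> x + \<beta>) * (r * sin (k \<bullet> x + \<beta>) + err x)\<bar> \<le> r + r0 / 4"
      by (simp add: abs_mult)
  qed measurable
  have s_int: "integrable lborel (\<lambda>x::'a. indicator (cube \<delta>) x * (sin (k \<bullet> x + \<beta>))\<^sup>2)"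
    by (rule integrable_on_cube[where B=1]) (auto simp: abs_square_le_1)
  have c_int: "integrable lborel (\<lambda>x::'a. indicator (cube \<delta>) x * 1 :: real)"
    by (rule integrable_on_cube[where B=1]) auto
  have "r0 / 4 * measure lborel (cube \<delta> :: 'a set) \<le> r * (measure lborel (cube \<delta> :: 'a set) / 2) - r0 / 4 * measure lborel (cube \<delta> :: 'a set)"
  proof -
    have "r0 * measure lborel (cube \<delta> :: 'a set) \<le> r * measure lborel (cube \<delta> :: 'a set)"
      using r0 by (intro mult_right_mono) (auto simp: r_def)
    then show ?thesis by (simp add: field_simps)
  qed
  also have "\<dots> = (\<integral>x. r * (indicator (cube \<delta>) x * (sin (k \<bullet> x + \<beta>))\<^sup>2) - r0 / 4 * (indicator (cube \<delta>) x * 1) \<partial>(lborel :: 'a measure))"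
    using s_int c_int cube_integral_sin_sin(2)[of \<delta> m m \<beta>, OF \<delta> m m]
    by (subst Bochner_Integration.integral_diff) (auto simp: k_def)
  also have "\<dots> \<le> (\<integral>x. ?J x \<partial>lborel)"
  proof (intro integral_mono J_int Bochner_Integration.integrable_diff integrable_mult_right s_int c_int)
    fix x :: 'a
    show "r * (indicator (cube \<delta>) x * (sin (k \<bullet> x + \<beta>))\<^sup>2) - r0 / 4 * (indicator (cube \<delta>) x * 1) \<le> ?J x"
    proof (cases "x \<in> cube \<delta>")
      case True
      have "\<bar>sin (k \<bullet> x + \<beta>) * err x\<bar> \<le> 1 * (r0 / 4)"
        unfolding abs_mult using err[OF True] by (intro mult_mono) auto
      then have "- (r0 / 4) \<le> sin (k \<bullet> x + \<beta>) * err x" by (simp add: abs_le_iff)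
      then show ?thesis using True by (simp add: algebra_simps power2_eq_square)
    qed simp
  qed
  also have "?J = (\<lambda>x. convolve \<eta> (\<lambda>x. p x * sin (k \<bullet> x)) x * (indicator (cube \<delta>) x * sin (k \<bullet> x + \<beta>) / p x))"
    by (auto simp: fun_eq_iff err_def)
  finally show ?thesis .
qed

section \<open>Gaussian densities modulated by sine waves\<close>

lemma gaussian_le: "s > 0 \<Longrightarrow> gaussian s (x::'a::euclidean_space) \<le> (s / (2 * pi)) powr (real DIM('a) / 2)"
  unfolding gaussian_def by (intro mult_left_le) auto

lemma gauss_eq_gaussian: "(gauss :: 'a::euclidean_space \<Rightarrow> real) = gaussian 1"
proof
  fix x :: 'a
  have "(1 / (2 * pi)) powr (real DIM('a) / 2) = (2 * pi) powr (- (real DIM('a) / 2))"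
    by (simp only: powr_minus_divide powr_one_eq_one powr_divide)
  then show "gauss x = gaussian 1 x"
    by (simp add: gauss_def gaussian_def)
qed

lemma gauss_conv_eq: "gauss_conv \<eta> = convolve \<eta> (gaussian 1)"
  by (simp add: fun_eq_iff gauss_conv_def convolve_def gauss_eq_gaussian)

lemma gaussian_prob_density: "s > 0 \<Longrightarrow> gaussian s \<in> prob_densities"
  by (intro prob_densitiesI gaussian_has_integral gaussian_measurable) (simp add: gaussian_pos less_imp_le)

lemma gaussian_dilate:
  assumes "\<nu> > 0"
  shows "\<nu> ^ DIM('a) * gaussian 1 (\<nu> *\<^sub>R x) = gaussian (\<nu>\<^sup>2) (x :: 'a::euclidean_space)"
proof -
  have "(\<nu>\<^sup>2 / (2 * pi)) powr (real DIM('a) / 2) = (\<nu>\<^sup>2) powr (real DIM('a) / 2) * (1 / (2 * pi)) powr (real DIM('a) / 2)"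
    by (subst powr_mult[symmetric]) auto
  also have "(\<nu>\<^sup>2) powr (real DIM('a) / 2) = \<nu> ^ DIM('a)"
  proof -
    have "\<nu>\<^sup>2 = \<nu> powr 2" using assms by simp
    then have "(\<nu>\<^sup>2) powr (real DIM('a) / 2) = \<nu> powr real DIM('a)" by (simp only: powr_powr) simp
    then show ?thesis using assms by (simp only: powr_realpow)
  qed
  finally show ?thesis
    using assms by (simp add: gaussian_def power_mult_distrib mult_ac)
qed

definition modulated :: "real \<Rightarrow> ('k \<Rightarrow> real) \<Rightarrow> ('k \<Rightarrow> 'a) \<Rightarrow> 'k set \<Rightarrow> 'a::euclidean_space \<Rightarrow> real" where
  "modulated s \<epsilon> \<kappa> S x = gaussian s x * (1 + (\<Sum>m\<in>S. \<epsilon> m * sin (\<kappa> m \<bullet> x)))"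

lemma gaussian_sin_integral:
  fixes \<kappa> :: "'a::euclidean_space"
  assumes "s > 0"
  shows "integrable lborel (\<lambda>x. gaussian s x * sin (\<kappa> \<bullet> x))" and "(\<integral>x. gaussian s x * sin (\<kappa> \<bullet> x) \<partial>lborel) = 0"
proof -
  note i = gaussian_fourier(1)[OF assms, of \<kappa>]
  show "integrable lborel (\<lambda>x. gaussian s x * sin (\<kappa> \<bullet> x))"
    using integrable_Im[OF i] by simp
  show "(\<integral>x. gaussian s x * sin (\<kappa> \<bullet> x) \<partial>lborel) = 0"
    using integral_Im[OF i] gaussian_fourier(2)[OF assms, of \<kappa>] by simp
qed

lemma modulated_bounds:
  assumes "s > 0" "(\<Sum>m\<in>S. \<bar>\<epsilon> m\<bar>) \<le> 1 / 2"
  shows "gaussian s x / 2 \<le> modulated s \<epsilon> \<kappa> S x" "modulated s \<epsilon> \<kappa> S x \<le> 2 * gaussian s x"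
proof -
  have "\<bar>\<Sum>m\<in>S. \<epsilon> m * sin (\<kappa> m \<bullet> x)\<bar> \<le> (\<Sum>m\<in>S. \<bar>\<epsilon> m * sin (\<kappa> m \<bullet> x)\<bar>)"
    by (rule sum_abs)
  also have "\<dots> \<le> (\<Sum>m\<in>S. \<bar>\<epsilon> m\<bar>)"
    by (intro sum_mono) (simp add: abs_mult mult_left_le)
  finally have *: "\<bar>\<Sum>m\<in>S. \<epsilon> m * sin (\<kappa> m \<bullet> x)\<bar> \<le> 1 / 2" using assms(2) by linarith
  have p: "gaussian s x > 0" using assms(1) by (rule gaussian_pos)
  show "gaussian s x / 2 \<le> modulated s \<epsilon> \<kappa> S x"
    using mult_left_mono[of "1 / 2" "1 + (\<Sum>m\<in>S. \<epsilon> m * sin (\<kappa> m \<bullet> x))" "gaussian s x"] p *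
    by (simp add: modulated_def)
  show "modulated s \<epsilon> \<kappa> S x \<le> 2 * gaussian s x"
    using mult_left_mono[of "1 + (\<Sum>m\<in>S. \<epsilon> m * sin (\<kappa> m \<bullet> x))" 2 "gaussian s x"] p *
    by (simp add: modulated_def)
qed

lemma modulated_measurable [measurable]: "modulated s \<epsilon> \<kappa> S \<in> borel_measurable borel"
  unfolding modulated_def by measurable

lemma modulated_prob_density:
  fixes \<kappa> :: "'k \<Rightarrow> 'a::euclidean_space"
  assumes "s > 0" "(\<Sum>m\<in>S. \<bar>\<epsilon> m\<bar>) \<le> 1 / 2"
  shows "modulated s \<epsilon> \<kappa> S \<in> prob_densities"
proof (rule prob_densitiesI)
  have eq: "modulated s \<epsilon> \<kappa> S = (\<lambda>x. gaussian s x + (\<Sum>m\<in>S. \<epsilon> m * (gaussian s x * sin (\<kappa> m \<bullet> x))))"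
    by (simp add: fun_eq_iff modulated_def algebra_simps sum_distrib_left)
  show "0 \<le> modulated s \<epsilon> \<kappa> S x" for x
    using modulated_bounds(1)[OF assms, of x \<kappa>] gaussian_pos[OF assms(1), of x] by linarith
  note i = gaussian_has_integral[OF assms(1), where 'a='a] gaussian_sin_integral[OF assms(1), where 'a='a]
  show "integrable lborel (modulated s \<epsilon> \<kappa> S)"
    unfolding eq using i by simp
  show "integral\<^sup>L lborel (modulated s \<epsilon> \<kappa> S) = 1"
    unfolding eq using i by (simp add: Bochner_Integration.integral_sum)
qed simp

text \<open>The family of modulated Gaussians is closed under Gaussian smoothing, with envelope, amplitudes and
  frequencies transformed separately.\<close>

lemma modulated_smoothing:
  fixes x :: "'a::euclidean_space"
  assumes "s > 0" "t > 0"
  shows "(\<integral>y. gaussian t (x - y) * modulated s \<epsilon> \<kappa> S y \<partial>lborel)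
    = modulated (s * t / (s + t)) (\<lambda>m. exp (- (norm (\<kappa> m))\<^sup>2 / (2 * (s + t))) * \<epsilon> m) (\<lambda>m. (t / (s + t)) *\<^sub>R \<kappa> m) S x"
proof -
  note c = gaussian_convolution[OF assms, of x]
  have int: "integrable lborel (\<lambda>y. gaussian t (x - y) * gaussian s y * sin (k \<bullet> y))" for k
    by (rule Bochner_Integration.integrable_bound[OF c(3)]) (auto simp: abs_mult mult_left_le)
  have "(\<integral>y. gaussian t (x - y) * modulated s \<epsilon> \<kappa> S y \<partial>lborel)
    = (\<integral>y. gaussian t (x - y) * gaussian s y
        + (\<Sum>m\<in>S. \<epsilon> m * (gaussian t (x - y) * gaussian s y * sin (\<kappa> m \<bullet> y))) \<partial>lborel)"
    by (intro Bochner_Integration.integral_cong refl) (simp add: modulated_def algebra_simps sum_distrib_left)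
  also have "\<dots> = gaussian (s * t / (s + t)) x
      + (\<Sum>m\<in>S. \<epsilon> m * (exp (- (norm (\<kappa> m))\<^sup>2 / (2 * (s + t))) * gaussian (s * t / (s + t)) x * sin ((t / (s + t)) * (\<kappa> m \<bullet> x))))"
    by (subst Bochner_Integration.integral_add)
       (simp_all add: c int Bochner_Integration.integral_sum del: times_divide_eq_left)
  also have "\<dots> = modulated (s * t / (s + t)) (\<lambda>m. exp (- (norm (\<kappa> m))\<^sup>2 / (2 * (s + t))) * \<epsilon> m) (\<lambda>m. (t / (s + t)) *\<^sub>R \<kappa> m) S x"
    by (simp add: modulated_def algebra_simps sum_distrib_left)
  finally show ?thesis .
qed

section \<open>Mixtures and regularity of the smoothed Gaussian\<close>

text \<open>By Fubini, mixing the dilated kernel over \<open>g\<close> is the same as smoothing \<open>g\<close> with the Gaussian of precision \<open>\<nu>\<^sup>2\<close>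
  first and with the rescaled measure afterwards.\<close>

lemma convolve_mem_mixtures:
  fixes \<eta> :: "'a::euclidean_space measure"
  assumes \<eta>: "borel_prob \<eta>" and \<nu>: "\<nu> > 0" and g: "g \<in> prob_densities"
  shows "convolve (distr \<eta> borel (\<lambda>y. y /\<^sub>R \<nu>)) (\<lambda>z. \<integral>\<mu>. gaussian (\<nu>\<^sup>2) (z - \<mu>) * g \<mu> \<partial>lborel)
      \<in> mixtures (gauss_conv \<eta>) \<nu>"
proof -
  interpret P: prob_space \<eta> using \<eta> by (simp add: borel_prob_def)
  interpret pair_sigma_finite lborel \<eta> ..
  have [measurable_cong]: "sets \<eta> = sets borel" using \<eta> by (simp add: borel_prob_def)
  note [measurable] = prob_densityD(1)[OF g]
  note gi = prob_densityD(3)[OF g] and g_nn = prob_densityD(2)[OF g]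
  define C where "C = (\<nu>\<^sup>2 / (2 * pi)) powr (real DIM('a) / 2)"
  have pos: "\<nu>\<^sup>2 > 0" using \<nu> by simp
  have gC: "\<bar>gaussian (\<nu>\<^sup>2) z\<bar> \<le> C" for z :: 'a
    using gaussian_le[OF pos, of z] gaussian_pos[OF pos, of z] by (simp add: C_def)
  have G: "borel_prob (density lborel (\<lambda>\<mu>. ennreal (g \<mu>)))"
    using g by (auto simp: borel_prob_def prob_densities_def emeasure_density intro!: prob_spaceI)
  have g_int: "integrable \<eta> (\<lambda>y. gaussian (\<nu>\<^sup>2) (x - \<mu> - y /\<^sub>R \<nu>))" for x \<mu> :: 'a
    by (rule integrable_bounded_prob[OF \<eta>, where B=C]) (use gC in auto)
  have "(\<integral>\<mu>. dilate \<nu> (gauss_conv \<eta>) (x - \<mu>) \<partial>density lborel (\<lambda>\<mu>. ennreal (g \<mu>)))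
      = (\<integral>y. (\<integral>\<mu>. gaussian (\<nu>\<^sup>2) (x - y - \<mu>) * g \<mu> \<partial>lborel) \<partial>distr \<eta> borel (\<lambda>y. y /\<^sub>R \<nu>))" for x
  proof -
    have dil: "dilate \<nu> (gauss_conv \<eta>) (x - \<mu>) = (\<integral>y. gaussian (\<nu>\<^sup>2) (x - \<mu> - y /\<^sub>R \<nu>) \<partial>\<eta>)" for \<mu>
      unfolding dilate_def gauss_conv_eq convolve_def integral_mult_right_zero[symmetric]
      using \<nu> by (intro Bochner_Integration.integral_cong refl)
        (simp add: gaussian_dilate[symmetric] scaleR_diff_right)
    have int: "integrable (lborel \<Otimes>\<^sub>M \<eta>) (\<lambda>(\<mu>, y). g \<mu> * gaussian (\<nu>\<^sup>2) (x - \<mu> - y /\<^sub>R \<nu>))"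
    proof (rule Fubini_integrable)
      have "(\<integral>y. norm (g \<mu> * gaussian (\<nu>\<^sup>2) (x - \<mu> - y /\<^sub>R \<nu>)) \<partial>\<eta>) \<le> C * g \<mu>" for \<mu>
      proof -
        have "(\<integral>y. norm (g \<mu> * gaussian (\<nu>\<^sup>2) (x - \<mu> - y /\<^sub>R \<nu>)) \<partial>\<eta>) \<le> (\<integral>y. C * g \<mu> \<partial>\<eta>)"
          by (intro integral_mono integrable_norm integrable_mult_right g_int)
             (auto simp: abs_mult g_nn mult.commute[of C] intro!: mult_left_mono gC)
        then show ?thesis by (simp add: P.prob_space)
      qed
      then show "integrable lborel (\<lambda>\<mu>. \<integral>y. norm (case (\<mu>, y) of (\<mu>, y) \<Rightarrow> g \<mu> * gaussian (\<nu>\<^sup>2) (x - \<mu> - y /\<^sub>R \<nu>)) \<partial>\<eta>)"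
        by (intro Bochner_Integration.integrable_bound[OF integrable_mult_right[OF gi, of C]])
           (auto intro: order_trans[OF _ abs_ge_self])
    qed (use g_int in \<open>auto intro!: integrable_mult_right\<close>)
    have "(\<integral>\<mu>. dilate \<nu> (gauss_conv \<eta>) (x - \<mu>) \<partial>density lborel (\<lambda>\<mu>. ennreal (g \<mu>)))
      = (\<integral>\<mu>. \<integral>y. g \<mu> * gaussian (\<nu>\<^sup>2) (x - \<mu> - y /\<^sub>R \<nu>) \<partial>\<eta> \<partial>lborel)"
      unfolding dil by (subst integral_density) (auto simp: g_nn)
    also have "\<dots> = (\<integral>y. \<integral>\<mu>. g \<mu> * gaussian (\<nu>\<^sup>2) (x - \<mu> - y /\<^sub>R \<nu>) \<partial>lborel \<partial>\<eta>)"
      by (rule Fubini_integral[OF int, symmetric])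
    also have "\<dots> = (\<integral>y. (\<integral>\<mu>. gaussian (\<nu>\<^sup>2) (x - y - \<mu>) * g \<mu> \<partial>lborel) \<partial>distr \<eta> borel (\<lambda>y. y /\<^sub>R \<nu>))"
      by (subst integral_distr) (auto simp: mult.commute algebra_simps)
    finally show ?thesis .
  qed
  then show ?thesis
    unfolding mixtures_def convolve_def using G by (auto intro!: exI[of _ "density lborel (\<lambda>\<mu>. ennreal (g \<mu>))"])
qed

text \<open>The transform of the convolution is that of \<open>w\<close> times an average of unimodular numbers.\<close>

lemma fourier_convolve_le:
  fixes \<eta> :: "'a::euclidean_space measure"
  assumes \<eta>: "borel_prob \<eta>" and w: "w \<in> prob_densities" and B: "\<And>x. w x \<le> B"
  shows "cmod (\<integral>x. cis (- (x \<bullet> \<xi>)) * complex_of_real (convolve \<eta> w x) \<partial>lborel)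
      \<le> cmod (\<integral>x. cis (- (x \<bullet> \<xi>)) * complex_of_real (w x) \<partial>lborel)"
proof -
  interpret P: prob_space \<eta> using \<eta> by (simp add: borel_prob_def)
  interpret pair_sigma_finite lborel \<eta> ..
  have [measurable_cong]: "sets \<eta> = sets borel" using \<eta> by (simp add: borel_prob_def)
  note [measurable] = prob_densityD(1)[OF w]
  have nn: "0 \<le> w x" for x by (rule prob_densityD(2)[OF w])
  have cis_meas [measurable]: "(\<lambda>x::'a. cis (- (x \<bullet> \<xi>))) \<in> borel_measurable borel"
    unfolding cis_conv_exp by measurable
  have w_int: "integrable \<eta> (\<lambda>y. w (x - y))" for x
    by (rule integrable_bounded_prob[OF \<eta>, where B=B]) (auto simp: nn B)
  have int: "integrable (lborel \<Otimes>\<^sub>M \<eta>) (\<lambda>(x, y). cis (- (x \<bullet> \<xi>)) * complex_of_real (w (x - y)))"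
  proof (rule Fubini_integrable)
    show "integrable lborel (\<lambda>x. \<integral>y. norm (case (x, y) of (x, y) \<Rightarrow> cis (- (x \<bullet> \<xi>)) * complex_of_real (w (x - y))) \<partial>\<eta>)"
      using prob_densityD(3)[OF convolve_prob_density[OF \<eta> w B]]
      by (simp add: norm_mult nn convolve_def[abs_def])
  qed (use w_int in \<open>auto intro!: integrable_mult_right\<close>)
  let ?I = "\<integral>x. cis (- (x \<bullet> \<xi>)) * complex_of_real (w x) \<partial>lborel"
  have "(\<integral>x. cis (- (x \<bullet> \<xi>)) * complex_of_real (convolve \<eta> w x) \<partial>lborel)
      = (\<integral>x. \<integral>y. cis (- (x \<bullet> \<xi>)) * complex_of_real (w (x - y)) \<partial>\<eta> \<partial>lborel)"
    by (simp add: convolve_def)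
  also have "\<dots> = (\<integral>y. \<integral>x. cis (- (x \<bullet> \<xi>)) * complex_of_real (w (x - y)) \<partial>lborel \<partial>\<eta>)"
    by (rule Fubini_integral[OF int, symmetric])
  also have "\<dots> = (\<integral>y. cis (- (y \<bullet> \<xi>)) * ?I \<partial>\<eta>)"
  proof (intro Bochner_Integration.integral_cong refl)
    fix y
    have "(\<integral>x. cis (- (x \<bullet> \<xi>)) * complex_of_real (w (x - y)) \<partial>lborel)
        = (\<integral>x. cis (- (y \<bullet> \<xi>)) * (cis (- ((x - y) \<bullet> \<xi>)) * complex_of_real (w (x - y))) \<partial>lborel)"
      by (simp add: mult.assoc[symmetric] cis_mult inner_diff_left)
    also have "\<dots> = cis (- (y \<bullet> \<xi>)) * ?I"
      by (simp add: lborel_integral_translate[of "\<lambda>x. cis (- (x \<bullet> \<xi>)) * complex_of_real (w x)"])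
    finally show "(\<integral>x. cis (- (x \<bullet> \<xi>)) * complex_of_real (w (x - y)) \<partial>lborel) = cis (- (y \<bullet> \<xi>)) * ?I" .
  qed
  also have "\<dots> = (\<integral>y. cis (- (y \<bullet> \<xi>)) \<partial>\<eta>) * ?I"
    by simp
  also have "cmod \<dots> \<le> 1 * cmod ?I"
    unfolding norm_mult
  proof (intro mult_right_mono)
    show "cmod (\<integral>y. cis (- (y \<bullet> \<xi>)) \<partial>\<eta>) \<le> 1"
      using Bochner_Integration.integral_norm_bound[of \<eta> "\<lambda>y. cis (- (y \<bullet> \<xi>))"] by (simp add: P.prob_space)
  qed simp
  finally show ?thesis by simp
qed

lemma gauss_conv_regular:
  fixes \<eta> :: "'a::euclidean_space measure"
  assumes \<eta>: "borel_prob \<eta>"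
  shows "gauss_conv \<eta> \<in> L2 \<inter> Linf \<inter> prob_densities"
    and "cmod (fourier (\<lambda>x. complex_of_real (gauss_conv \<eta> x)) \<xi>)
        \<le> (2 * pi) powr (- (real DIM('a) / 2)) * exp (- (1 / 2) * (norm \<xi>)\<^sup>2)"
proof -
  let ?B = "(1 / (2 * pi)) powr (real DIM('a) / 2)"
  note gd = gaussian_prob_density[of 1, OF zero_less_one, where 'a='a]
  note gb = gaussian_le[of 1, OF zero_less_one, where 'a='a]
  note m = gaussian_measurable[of 1, where 'a='a]
  have b: "\<bar>gaussian 1 x\<bar> \<le> ?B" for x :: 'a
    using gb[of x] gaussian_pos[of 1 x] by simp
  show "gauss_conv \<eta> \<in> L2 \<inter> Linf \<inter> prob_densities"
    unfolding gauss_conv_eq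
    using convolve_L2[OF \<eta> gd gb] convolve_prob_density[OF \<eta> gd gb]
      convolve_measurable[OF \<eta> m] convolve_bound[OF \<eta> m b]
    by (auto simp: Linf_def)
  have "cmod (\<integral>x. cis (- (x \<bullet> \<xi>)) * complex_of_real (gauss_conv \<eta> x) \<partial>lborel)
      \<le> cmod (\<integral>x. cis (- (x \<bullet> \<xi>)) * complex_of_real (gaussian 1 x) \<partial>lborel)"
    unfolding gauss_conv_eq by (rule fourier_convolve_le[OF \<eta> gd gb])
  also have "(\<integral>x. cis (- (x \<bullet> \<xi>)) * complex_of_real (gaussian 1 x) \<partial>lborel) = complex_of_real (exp (- (norm \<xi>)\<^sup>2 / 2))"
    using gaussian_fourier(2)[of 1 "- \<xi>"] by (simp add: mult.commute inner_commute)
  finally show "cmod (fourier (\<lambda>x. complex_of_real (gauss_conv \<eta> x)) \<xi>)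
        \<le> (2 * pi) powr (- (real DIM('a) / 2)) * exp (- (1 / 2) * (norm \<xi>)\<^sup>2)"
    by (simp add: fourier_def norm_mult cis_conv_exp mult_left_mono)
qed

section \<open>The lower bound\<close>

text \<open>The trade-off between the number of modes and the positivity of the mixing density. The amplification
  \<open>exp (c * M\<^sup>2)\<close> together with the number \<open>M ^ d\<close> of modes is at most \<open>exp ((d + c) * M\<^sup>2)\<close>, so a
  cut-off \<open>M\<close> of order \<open>sqrt (ln n)\<close> keeps it below a multiple of \<open>sqrt n\<close>.\<close>

lemma mode_count:
  fixes c :: real and d :: nat
  assumes "c \<ge> 0" "d \<ge> 1"
  shows "\<exists>\<tau>>0. \<tau> \<le> 1 / 2 \<and> (\<exists>b>0. \<forall>n\<ge>3. \<exists>M::nat.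
      real M ^ d * (\<tau> / sqrt (real n) * exp (c * (real M)\<^sup>2)) \<le> 1 / 2 \<and>
      (b * ln (real n)) powr (real d / 2) \<le> real M ^ d)"
proof -
  define h where "h = real d + c"
  have h: "h > 0" using assms by (simp add: h_def)
  \<comment> \<open>As \<open>M\<^sup>2 \<le> 2 * b * ln n + 2\<close> below, this \<open>b\<close> gives \<open>exp (h * M\<^sup>2) \<le> sqrt n * exp (2 * h)\<close>,
    and \<open>\<tau>\<close> absorbs the constant; the summand 2 pays for rounding \<open>M\<close> up.\<close>
  define b where "b = 1 / (4 * h)"
  define \<tau> where "\<tau> = exp (- (2 * h)) / 2"
  have b: "b > 0" and \<tau>: "\<tau> > 0" "\<tau> \<le> 1 / 2" using h by (auto simp: b_def \<tau>_def)
  have "\<exists>M::nat. real M ^ d * (\<tau> / sqrt (real n) * exp (c * (real M)\<^sup>2)) \<le> 1 / 2 \<and>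
      (b * ln (real n)) powr (real d / 2) \<le> real M ^ d" if n: "n \<ge> 3" for n :: nat
  proof -
    define L where "L = ln (real n)"
    have L: "L > 0" using n by (simp add: L_def)
    define x where "x = sqrt (b * L)"
    have x: "x > 0" "x\<^sup>2 = b * L" using b L by (auto simp: x_def)
    define M where "M = nat \<lceil>x\<rceil>"
    have Mx: "x \<le> real M" "real M \<le> x + 1" using x by (auto simp: M_def)
    have "(real M)\<^sup>2 \<le> (x + 1)\<^sup>2" using Mx(2) by (intro power_mono) auto
    also have "\<dots> \<le> 2 * x\<^sup>2 + 2"
      using zero_le_power2[of "x - 1"] by (simp add: power2_sum power2_diff)
    finally have M2: "(real M)\<^sup>2 \<le> 2 * (b * L) + 2" by (simp add: x)
    have "real M \<le> exp (real M)" using exp_ge_add_one_self[of "real M"] by linarith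
    then have "real M ^ d \<le> exp (real M) ^ d" by (intro power_mono) auto
    also have "\<dots> = exp (real d * real M)" by (simp add: exp_of_nat_mult)
    also have "\<dots> \<le> exp (real d * (real M)\<^sup>2)"
    proof -
      have "real M \<le> (real M)\<^sup>2" by (cases M) (auto simp: power2_eq_square)
      then show ?thesis by (simp add: mult_left_mono)
    qed
    finally have "real M ^ d * exp (c * (real M)\<^sup>2) \<le> exp (real d * (real M)\<^sup>2) * exp (c * (real M)\<^sup>2)"
      by (intro mult_right_mono) auto
    also have "\<dots> = exp (h * (real M)\<^sup>2)"
      by (simp add: h_def exp_add[symmetric] algebra_simps)
    also have "\<dots> \<le> exp (h * (2 * (b * L) + 2))"
      using mult_left_mono[OF M2, of h] h by simp
    also have "h * (2 * (b * L) + 2) = L / 2 + 2 * h"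
      using h by (simp add: b_def field_simps)
    also have "exp (L / 2 + 2 * h) = sqrt (real n) * exp (2 * h)"
    proof -
      have "exp (L / 2) = sqrt (real n)"
        using n by (simp add: L_def powr_half_sqrt[symmetric] powr_def)
      then show ?thesis by (simp add: exp_add)
    qed
    finally have "real M ^ d * exp (c * (real M)\<^sup>2) \<le> sqrt (real n) * exp (2 * h)" .
    then have "\<tau> / sqrt (real n) * (real M ^ d * exp (c * (real M)\<^sup>2)) \<le> \<tau> / sqrt (real n) * (sqrt (real n) * exp (2 * h))"
      using \<tau> by (intro mult_left_mono) auto
    also have "\<dots> = 1 / 2" using n by (simp add: \<tau>_def exp_minus)
    finally have 1: "real M ^ d * (\<tau> / sqrt (real n) * exp (c * (real M)\<^sup>2)) \<le> 1 / 2"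
      by (simp add: mult_ac)
    have "(b * L) powr (real d / 2) = x ^ d"
    proof -
      have "(b * L) powr (real d / 2) = ((b * L) powr (1 / 2)) powr real d" by (simp add: powr_powr)
      also have "(b * L) powr (1 / 2) = x" using b L by (simp add: x_def powr_half_sqrt)
      finally show ?thesis using x by (simp add: powr_realpow)
    qed
    also have "\<dots> \<le> real M ^ d" using Mx x by (intro power_mono) auto
    finally show ?thesis using 1 by (auto simp: L_def)
  qed
  with b \<tau> show ?thesis by blast
qed

lemma fourier_inf_le: "fourier_inf \<eta> \<le> cmod (fourier_measure \<eta> \<xi>)"
  unfolding fourier_inf_def by (rule cINF_lower) (auto intro!: bdd_belowI[of _ 0])

lemma norm_lattice_point_le:
  fixes m :: "'a::euclidean_space \<Rightarrow> int"
  assumes "\<And>b. b \<in> Basis \<Longrightarrow> \<bar>real_of_int (m b)\<bar> \<le> r"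
  shows "(norm (lattice_point \<delta> m))\<^sup>2 \<le> \<delta>\<^sup>2 * (real DIM('a) * r\<^sup>2)"
proof -
  have "(norm (lattice_point \<delta> m))\<^sup>2 = (\<Sum>b\<in>Basis. (\<delta> * real_of_int (m b))\<^sup>2)"
    unfolding power2_norm_eq_inner euclidean_inner[of "lattice_point \<delta> m" "lattice_point \<delta> m"]
    by (simp add: lattice_point_def power2_eq_square)
  also have "\<dots> \<le> (\<Sum>b\<in>(Basis :: 'a set). \<delta>\<^sup>2 * r\<^sup>2)"
    unfolding power_mult_distrib
  proof (intro sum_mono mult_left_mono)
    fix b :: 'a assume "b \<in> Basis"
    then show "(real_of_int (m b))\<^sup>2 \<le> r\<^sup>2"
      using power_mono[OF assms, of b 2] by simp
  qed simp
  finally show ?thesis by (simp add: mult_ac)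
qed

text \<open>The number of modes \<open>M ^ d\<close> and their common amplitude \<open>\<sigma>\<close> after smoothing are left free, subject to the two
  conditions of the construction: the mixing densities must be positive, where the mode \<open>m\<close> needs the
  amplitude \<open>\<sigma>\<close> amplified by at most \<open>exp (c * M\<^sup>2)\<close>, and a single mode must not be detectable from \<open>n\<close> observations.\<close>

lemma minimax_lower_bound_modes:
  fixes \<eta> :: "'a::euclidean_space measure"
  assumes \<eta>: "borel_prob \<eta>" and \<nu>: "\<nu> > 0" and a: "fourier_inf \<eta> > 0"
  shows "\<exists>A>0. \<exists>c\<ge>0. \<forall>n M \<sigma>. 0 \<le> \<sigma> \<longrightarrow> real M ^ DIM('a) * (\<sigma> * exp (c * (real M)\<^sup>2)) \<le> 1 / 2 \<longrightarrow>
      real n * (2 * \<sigma>)\<^sup>2 \<le> 1 \<longrightarrow>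
      ennreal (A * \<sigma>\<^sup>2 * real M ^ DIM('a)) \<le> minimax_risk n (mixtures (gauss_conv \<eta>) \<nu>)"
proof -
  define \<eta>' where "\<eta>' = distr \<eta> borel (\<lambda>y. y /\<^sub>R \<nu>)"
  have [measurable_cong]: "sets \<eta> = sets borel" using \<eta> by (simp add: borel_prob_def)
  have \<eta>': "borel_prob \<eta>'"
    using \<eta> unfolding borel_prob_def \<eta>'_def by (auto intro!: prob_space.prob_space_distr)
  define r0 where "r0 = (2 * pi) powr (real DIM('a) / 2) * fourier_inf \<eta>"
  have r0: "r0 > 0" using a by (simp add: r0_def)
  have r0_le: "r0 \<le> cmod (\<integral>y. cis (- (k \<bullet> y)) \<partial>\<eta>')" for k
  proof -
    have cis_meas: "(\<lambda>y. cis (- (k \<bullet> y))) \<in> borel_measurable borel"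
      unfolding cis_conv_exp by measurable
    have "(\<integral>y. cis (- (k \<bullet> y)) \<partial>\<eta>') = (\<integral>y. cis (- (k \<bullet> (y /\<^sub>R \<nu>))) \<partial>\<eta>)"
      unfolding \<eta>'_def by (rule integral_distr) (use cis_meas in auto)
    also have "\<dots> = (\<integral>y. exp (- (\<i> * complex_of_real (y \<bullet> (k /\<^sub>R \<nu>)))) \<partial>\<eta>)"
      by (simp add: cis_conv_exp inner_commute)
    finally have "cmod (fourier_measure \<eta> (k /\<^sub>R \<nu>))
        = (2 * pi) powr (- (real DIM('a) / 2)) * cmod (\<integral>y. cis (- (k \<bullet> y)) \<partial>\<eta>')"
      by (simp add: fourier_measure_def norm_mult)
    with fourier_inf_le[of \<eta> "k /\<^sub>R \<nu>"]
    have "r0 \<le> (2 * pi) powr (real DIM('a) / 2) * ((2 * pi) powr (- (real DIM('a) / 2)) * cmod (\<integral>y. cis (- (k \<bullet> y)) \<partial>\<eta>'))"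
      unfolding r0_def by (intro mult_left_mono) auto
    then show ?thesis
      by (simp add: mult.assoc[symmetric] powr_add[symmetric])
  qed
  obtain \<delta> where \<delta>: "0 < \<delta>" "\<delta> < \<nu>" and close: "\<And>x. x \<in> cube \<delta> \<Longrightarrow>
      integrable \<eta>' (\<lambda>y. \<bar>gaussian (\<delta>\<^sup>2) (x - y) / gaussian (\<delta>\<^sup>2) x - 1\<bar>) \<and>
      (\<integral>y. \<bar>gaussian (\<delta>\<^sup>2) (x - y) / gaussian (\<delta>\<^sup>2) x - 1\<bar> \<partial>\<eta>') \<le> r0 / 4"
    using slowly_varying_gaussian[OF \<eta>', of "r0 / 4" \<nu>] r0 \<nu> by auto
  define p :: "'a \<Rightarrow> real" where "p = gaussian (\<delta>\<^sup>2)"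
  define t where "t = \<nu>\<^sup>2"
  \<comment> \<open>The precision of the mixing density for which smoothing with precision \<open>t\<close> yields precision \<open>\<delta>\<^sup>2\<close>,
    i.e. the slowly varying envelope \<open>p\<close>.\<close>
  define s where "s = t * \<delta>\<^sup>2 / (t - \<delta>\<^sup>2)"
  have t: "t > 0" and \<delta>2: "\<delta>\<^sup>2 > 0" "\<delta>\<^sup>2 < t"
    using \<nu> \<delta> by (auto simp: t_def power_strict_mono)
  have s: "s > 0" unfolding s_def by (intro divide_pos_pos mult_pos_pos t \<delta>2(1)) (use \<delta>2(2) in simp)
  have q: "s * t / (s + t) = \<delta>\<^sup>2"
  proof -
    have "s * (t - \<delta>\<^sup>2) = t * \<delta>\<^sup>2" using \<delta>2 by (simp add: s_def)
    then have "s * t = \<delta>\<^sup>2 * (s + t)" by (simp add: algebra_simps)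
    then show ?thesis using s t by (simp add: field_simps)
  qed
  have "\<forall>k. \<exists>\<beta>. \<forall>z. (\<integral>y. sin (z - k \<bullet> y) \<partial>\<eta>') = cmod (\<integral>y. cis (- (k \<bullet> y)) \<partial>\<eta>') * sin (z + \<beta>)"
    using sine_averaged_phase[OF \<eta>'] by blast
  then obtain \<beta> where \<beta>: "\<And>k z. (\<integral>y. sin (z - k \<bullet> y) \<partial>\<eta>') = cmod (\<integral>y. cis (- (k \<bullet> y)) \<partial>\<eta>') * sin (z + \<beta> k)"
    by metis
  define k where "k = (lattice_point \<delta> :: ('a \<Rightarrow> int) \<Rightarrow> 'a)"
  define \<kappa> where "\<kappa> m = ((s + t) / t) *\<^sub>R k m" for m
  define c where "c = ((s + t) / t)\<^sup>2 * \<delta>\<^sup>2 * real DIM('a) / (2 * (s + t))"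
  define V where "V = measure lborel (cube \<delta> :: 'a set)"
  define D where "D = sqrt (real DIM('a)) * pi"
  define p0 where "p0 = (\<delta>\<^sup>2 / (2 * pi)) powr (real DIM('a) / 2) * exp (- (D\<^sup>2 / 2))"
  define B where "B = V / (2 * p0\<^sup>2)"
  have V: "V > 0" unfolding V_def by (rule cube_measure_pos[OF \<delta>(1)])
  have p0: "p0 > 0" using \<delta> by (simp add: p0_def)
  have B: "B > 0" using V p0 by (simp add: B_def)
  have p_ge: "p0 \<le> p x" if "x \<in> cube \<delta>" for x
  proof -
    have "(\<delta> * norm x)\<^sup>2 \<le> D\<^sup>2"
      using norm_cube_le[OF \<delta>(1) that] \<delta>(1) by (intro power_mono) (auto simp: D_def)
    then have "exp (- (D\<^sup>2 / 2)) \<le> exp (- \<delta>\<^sup>2 * (norm x)\<^sup>2 / 2)"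
      by (simp add: power_mult_distrib)
    then show ?thesis
      unfolding p0_def p_def gaussian_def by (rule mult_left_mono) simp
  qed
  have p_pos: "p x > 0" for x unfolding p_def using \<delta>2 by (intro gaussian_pos)
  have p_le: "p x \<le> (\<delta>\<^sup>2 / (2 * pi)) powr (real DIM('a) / 2)" for x
    unfolding p_def by (rule gaussian_le[OF \<delta>2(1)])
  define A where "A = (r0 / 4 * V)\<^sup>2 / (8 * B)"
  have A: "A > 0" using r0 V B by (simp add: A_def)
  have "c \<ge> 0" using s t by (simp add: c_def)
  have main: "ennreal (A * \<sigma>\<^sup>2 * real M ^ DIM('a)) \<le> minimax_risk n (mixtures (gauss_conv \<eta>) \<nu>)"
    if \<sigma>: "0 \<le> \<sigma>" and small: "real M ^ DIM('a) * (\<sigma> * exp (c * (real M)\<^sup>2)) \<le> 1 / 2"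
      and n: "real n * (2 * \<sigma>)\<^sup>2 \<le> 1" for n M :: nat and \<sigma> :: real
  proof -
    define K where "K = (Basis :: 'a set) \<rightarrow>\<^sub>E {1..int M}"
    have K: "finite K" "card K = M ^ DIM('a)"
      by (auto simp: K_def finite_PiE card_PiE)
    have K_pos: "m b > 0" if "m \<in> K" "b \<in> Basis" for m b
      using that by (auto simp: K_def PiE_iff)
    have K_sub: "K \<subseteq> Basis \<rightarrow>\<^sub>E {0<..}"
      unfolding K_def by (intro PiE_mono) auto
    \<comment> \<open>The amplitude before smoothing compensates for the damping of the frequency \<open>\<kappa> m\<close>.\<close>
    define \<epsilon> where "\<epsilon> m = \<sigma> * exp ((norm (\<kappa> m))\<^sup>2 / (2 * (s + t)))" for m
    have \<epsilon>_le: "\<bar>\<epsilon> m\<bar> \<le> \<sigma> * exp (c * (real M)\<^sup>2)" if m: "m \<in> K" for m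
    proof -
      have "(norm (k m))\<^sup>2 \<le> \<delta>\<^sup>2 * (real DIM('a) * (real M)\<^sup>2)"
        unfolding k_def using m by (intro norm_lattice_point_le) (auto simp: K_def PiE_iff)
      then have "(norm (\<kappa> m))\<^sup>2 / (2 * (s + t)) \<le> ((s + t) / t)\<^sup>2 * (\<delta>\<^sup>2 * (real DIM('a) * (real M)\<^sup>2)) / (2 * (s + t))"
        using s t unfolding \<kappa>_def norm_scaleR power_mult_distrib power2_abs
        by (intro divide_right_mono mult_left_mono) auto
      also have "\<dots> = c * (real M)\<^sup>2" by (simp add: c_def)
      finally show ?thesis using \<sigma> by (simp add: \<epsilon>_def abs_mult mult_left_mono)
    qed
    have \<epsilon>_sum: "(\<Sum>m\<in>S. \<bar>\<epsilon> m\<bar>) \<le> 1 / 2" if S: "S \<subseteq> K" for S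
    proof -
      have "(\<Sum>m\<in>S. \<bar>\<epsilon> m\<bar>) \<le> (\<Sum>m\<in>K. \<bar>\<epsilon> m\<bar>)"
        using K S by (intro sum_mono2) auto
      also have "\<dots> \<le> (\<Sum>m\<in>K. \<sigma> * exp (c * (real M)\<^sup>2))" by (intro sum_mono \<epsilon>_le)
      also have "\<dots> \<le> 1 / 2" using small by (simp add: K)
      finally show ?thesis .
    qed
    have \<sigma>_sum: "(\<Sum>m\<in>S. \<bar>\<sigma>\<bar>) \<le> 1 / 2" if S: "S \<subseteq> K" for S
    proof -
      have "(\<Sum>m\<in>S. \<bar>\<sigma>\<bar>) \<le> (\<Sum>m\<in>S. \<bar>\<epsilon> m\<bar>)"
        using \<sigma> s t by (intro sum_mono) (simp add: \<epsilon>_def abs_mult mult_left_le mult_le_cancel_left1)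
      with \<epsilon>_sum[OF S] show ?thesis by linarith
    qed
    define w where "w = modulated (\<delta>\<^sup>2) (\<lambda>_. \<sigma>) k"
    define f where "f S = convolve \<eta>' (w S)" for S
    have w_lo: "p x / 2 \<le> w S x" and w_hi: "w S x \<le> 2 * p x" if "S \<subseteq> K" for S x
      using modulated_bounds[OF \<delta>2(1) \<sigma>_sum[OF that], where x=x and \<kappa>=k] by (simp_all add: w_def p_def)
    define C where "C = 2 * (\<delta>\<^sup>2 / (2 * pi)) powr (real DIM('a) / 2)"
    have w_C: "w S x \<le> C" if "S \<subseteq> K" for S x
      using w_hi[OF that, of x] p_le[of x] by (simp add: C_def)
    have w_dens: "w S \<in> prob_densities" if "S \<subseteq> K" for S
      unfolding w_def by (rule modulated_prob_density[OF \<delta>2(1) \<sigma>_sum[OF that]])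
    have w_meas: "w S \<in> borel_measurable borel" for S by (simp add: w_def)
    have w_abs: "\<bar>w S x\<bar> \<le> C" if "S \<subseteq> K" for S x
      using w_C[OF that, of x] w_lo[OF that, of x] p_pos[of x] by simp
    have p_meas: "p \<in> borel_measurable borel" by (simp add: p_def)
    have p_C: "\<bar>p x\<bar> \<le> C" for x using p_le[of x] p_pos[of x] by (simp add: C_def)
    have f_lo: "convolve \<eta>' p x \<le> 2 * f S x" if "S \<subseteq> K" for S x
    proof -
      have "convolve \<eta>' (\<lambda>x. p x / 2) x \<le> convolve \<eta>' (w S) x"
      proof (intro convolve_mono[OF \<eta>', where B=C] w_meas w_abs that w_lo)
        show "\<bar>p y / 2\<bar> \<le> C" for y using p_C[of y] p_pos[of y] by simp
      qed (use p_meas in measurable)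
      then show ?thesis by (simp add: f_def convolve_def)
    qed
    have p_conv_pos: "convolve \<eta>' p x > 0" for x
    proof -
      interpret P: prob_space \<eta>' using \<eta>' by (simp add: borel_prob_def)
      have "integrable \<eta>' (\<lambda>y. p (x - y))"
        by (rule integrable_bounded_prob[OF \<eta>', where B=C]) (use p_meas p_C in auto)
      from P.integral_less_AE_space[OF _ this, of "\<lambda>_. 0"] show ?thesis
        by (simp add: convolve_def p_pos P.emeasure_space_1)
    qed
    have diff: "f (insert m S) x - f S x = \<sigma> * convolve \<eta>' (\<lambda>x. p x * sin (k m \<bullet> x)) x"
      if "m \<in> K" "S \<subseteq> K - {m}" for m S x
    proof -
      have S: "finite S" "m \<notin> S" "S \<subseteq> K" "insert m S \<subseteq> K"
        using that K finite_subset[of S K] by auto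
      have int: "integrable \<eta>' (\<lambda>y. w T (x - y))" if "T \<subseteq> K" for T
        by (rule integrable_bounded_prob[OF \<eta>', where B=C])
           (use w_meas[of T] w_abs[OF that] in auto)
      have "f (insert m S) x - f S x = (\<integral>y. w (insert m S) (x - y) - w S (x - y) \<partial>\<eta>')"
        unfolding f_def convolve_def by (intro Bochner_Integration.integral_diff[symmetric] int S)
      also have "\<dots> = (\<integral>y. \<sigma> * (p (x - y) * sin (k m \<bullet> (x - y))) \<partial>\<eta>')"
        using S by (intro Bochner_Integration.integral_cong refl) (simp add: w_def modulated_def p_def algebra_simps)
      finally show ?thesis by (simp add: convolve_def)
    qed
    have "ennreal (real (card K) * (\<sigma> * (r0 / 4 * V))\<^sup>2 / (8 * B)) \<le> minimax_risk n (mixtures (gauss_conv \<eta>) \<nu>)"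
    proof (rule assouad_lower_bound[where \<rho> = "2 * \<sigma>" and f = f
          and \<psi> = "\<lambda>m x. indicator (cube \<delta>) x * sin (lattice_point \<delta> m \<bullet> x + \<beta> (k m)) / p x"])
      show "finite K" by (rule K)
      fix S assume S: "S \<subseteq> K"
      show "f S \<in> prob_densities"
        unfolding f_def by (rule convolve_prob_density[OF \<eta>' w_dens[OF S] w_C[OF S]])
      show "f S \<in> L2"
        unfolding f_def by (rule convolve_L2[OF \<eta>' w_dens[OF S] w_C[OF S]])
      show "0 < f S x" for x
        using f_lo[OF S, of x] p_conv_pos[of x] by linarith
      have "(\<lambda>z. \<integral>\<mu>. gaussian t (z - \<mu>) * modulated s \<epsilon> \<kappa> S \<mu> \<partial>lborel) = w S"
      proof
        fix z
        have "exp (- (norm (\<kappa> m))\<^sup>2 / (2 * (s + t))) * \<epsilon> m = \<sigma>" for m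
          by (simp add: \<epsilon>_def exp_minus)
        moreover have "(t / (s + t)) *\<^sub>R \<kappa> m = k m" for m
          using s t by (simp add: \<kappa>_def)
        ultimately show "(\<integral>\<mu>. gaussian t (z - \<mu>) * modulated s \<epsilon> \<kappa> S \<mu> \<partial>lborel) = w S z"
          unfolding modulated_smoothing[OF s t] q w_def by simp
      qed
      then show "f S \<in> mixtures (gauss_conv \<eta>) \<nu>"
        using convolve_mem_mixtures[OF \<eta> \<nu> modulated_prob_density[OF s \<epsilon>_sum[OF S], where \<kappa>=\<kappa>]]
        by (simp add: f_def \<eta>'_def t_def)
    next
      fix m S x assume m: "m \<in> K" and S: "S \<subseteq> K - {m}"
      have "\<bar>convolve \<eta>' (\<lambda>x. p x * sin (k m \<bullet> x)) x\<bar> \<le> convolve \<eta>' p x"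
      proof -
        have le: "\<bar>p y * sin (k m \<bullet> y)\<bar> \<le> p y" for y
          using p_pos[of y] by (simp add: abs_mult mult_left_le)
        have le_C: "\<bar>p y * sin (k m \<bullet> y)\<bar> \<le> C" for y
          using le[of y] p_C[of y] by linarith
        have [measurable]: "p \<in> borel_measurable borel" by (rule p_meas)
        have "convolve \<eta>' (\<lambda>x. p x * sin (k m \<bullet> x)) x \<le> convolve \<eta>' p x"
          by (rule convolve_mono[OF \<eta>' _ p_meas le_C p_C])
             (measurable, use le abs_le_iff in blast)
        moreover have "convolve \<eta>' (\<lambda>x. - (p x * sin (k m \<bullet> x))) x \<le> convolve \<eta>' p x"
        proof (rule convolve_mono[OF \<eta>' _ p_meas _ p_C])
          show "\<bar>- (p y * sin (k m \<bullet> y))\<bar> \<le> C" for y using le_C[of y] by simp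
          show "- (p y * sin (k m \<bullet> y)) \<le> p y" for y using le[of y] by linarith
        qed measurable
        ultimately show ?thesis by (simp add: convolve_def abs_le_iff)
      qed
      also have "\<dots> \<le> 2 * f S x" using S by (intro f_lo) auto
      finally have "\<sigma> * \<bar>convolve \<eta>' (\<lambda>x. p x * sin (k m \<bullet> x)) x\<bar> \<le> \<sigma> * (2 * f S x)"
        using \<sigma> by (rule mult_left_mono)
      then show "\<bar>f (insert m S) x - f S x\<bar> \<le> 2 * \<sigma> * f S x"
        unfolding diff[OF m S] using \<sigma> by (simp add: abs_mult mult_ac)
    next
      show "0 \<le> 2 * \<sigma>" "real n * (2 * \<sigma>)\<^sup>2 \<le> 1" using \<sigma> n by auto
      show "B > 0" by (rule B)
      show "0 \<le> \<sigma> * (r0 / 4 * V)" using \<sigma> r0 V by simp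
    next
      fix m assume "m \<in> K"
      show "(\<lambda>x. indicator (cube \<delta>) x * sin (lattice_point \<delta> m \<bullet> x + \<beta> (k m)) / p x) \<in> L2"
        by (rule weighted_bessel(1)[where K=K and w=p and \<beta>="\<lambda>m. \<beta> (k m)", OF K(1) K_sub \<delta>(1) p_meas p0 p_ge]) auto
    next
      fix h :: "'a \<Rightarrow> real" assume h: "h \<in> L2"
      show "(\<Sum>m\<in>K. (\<integral>x. h x * (indicator (cube \<delta>) x * sin (lattice_point \<delta> m \<bullet> x + \<beta> (k m)) / p x) \<partial>lborel)\<^sup>2)
          \<le> B * (\<integral>x. (h x)\<^sup>2 \<partial>lborel)"
        unfolding B_def V_def
        by (rule weighted_bessel(2)[where K=K and w=p and \<beta>="\<lambda>m. \<beta> (k m)", OF K(1) K_sub \<delta>(1) p_meas p0 p_ge _ h]) auto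
    next
      fix m S assume m: "m \<in> K" and S: "S \<subseteq> K - {m}"
      have "r0 / 4 * V \<le> (\<integral>x. convolve \<eta>' (\<lambda>x. p x * sin (k m \<bullet> x)) x
          * (indicator (cube \<delta>) x * sin (lattice_point \<delta> m \<bullet> x + \<beta> (k m)) / p x) \<partial>lborel)"
        unfolding V_def p_def k_def
        by (rule smoothed_sine_separation[OF \<eta>' \<delta>(1) K_pos[OF m]])
           (use r0_le close \<beta> in \<open>auto simp: k_def\<close>)
      then have "\<sigma> * (r0 / 4 * V) \<le> \<sigma> * (\<integral>x. convolve \<eta>' (\<lambda>x. p x * sin (k m \<bullet> x)) x
          * (indicator (cube \<delta>) x * sin (lattice_point \<delta> m \<bullet> x + \<beta> (k m)) / p x) \<partial>lborel)"
        using \<sigma> by (rule mult_left_mono)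
      also have "\<dots> = (\<integral>x. (f (insert m S) x - f S x)
          * (indicator (cube \<delta>) x * sin (lattice_point \<delta> m \<bullet> x + \<beta> (k m)) / p x) \<partial>lborel)"
        unfolding diff[OF m S] by (simp add: mult.assoc del: times_divide_eq_right)
      finally show "\<sigma> * (r0 / 4 * V) \<le> \<bar>\<integral>x. (f (insert m S) x - f S x)
          * (indicator (cube \<delta>) x * sin (lattice_point \<delta> m \<bullet> x + \<beta> (k m)) / p x) \<partial>lborel\<bar>"
        by linarith
    qed
    also have "real (card K) * (\<sigma> * (r0 / 4 * V))\<^sup>2 / (8 * B) = A * \<sigma>\<^sup>2 * real M ^ DIM('a)"
      by (simp add: K A_def power_mult_distrib power_divide)
    finally show ?thesis .
  qed
  with A \<open>c \<ge> 0\<close> show ?thesis by blast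
qed

theorem theorem17:
  fixes \<nu> :: real and \<phi> :: "'a::euclidean_space \<Rightarrow> real" and \<eta> :: "'a measure"
  assumes "\<nu> > 0"
    and "borel_prob \<eta>"
    and "\<phi> = gauss_conv \<eta>"
    and "fourier_inf \<eta> > 0"
  shows "(\<exists>C'>0. \<forall>n\<ge>3. minimax_risk n (mixtures \<phi> \<nu>) \<ge>
            ennreal (C' * ((fourier_inf \<eta>)\<^sup>2 * \<nu> ^ DIM('a) *
              (ln (real n) powr (real DIM('a) / 2) / real n))))
       \<and> \<phi> \<in> L2 \<inter> Linf \<inter> prob_densities
       \<and> (\<exists>c>0. \<exists>C>0. \<forall>\<xi>. cmod (fourier (\<lambda>x. complex_of_real (\<phi> x)) \<xi>)
              \<le> C * exp (- c * (norm \<xi>)\<^sup>2))"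
proof (intro conjI)
  obtain A c where A: "A > 0" and c: "c \<ge> 0" and modes: "\<And>n M \<sigma>. 0 \<le> \<sigma> \<Longrightarrow>
      real M ^ DIM('a) * (\<sigma> * exp (c * (real M)\<^sup>2)) \<le> 1 / 2 \<Longrightarrow> real n * (2 * \<sigma>)\<^sup>2 \<le> 1 \<Longrightarrow>
      ennreal (A * \<sigma>\<^sup>2 * real M ^ DIM('a)) \<le> minimax_risk n (mixtures \<phi> \<nu>)"
    using minimax_lower_bound_modes[OF assms(2,1,4)] unfolding assms(3) by blast
  have "DIM('a) \<ge> 1" by (simp add: DIM_positive Suc_leI)
  from mode_count[OF c this] obtain \<tau> b where \<tau>: "\<tau> > 0" "\<tau> \<le> 1 / 2" and b: "b > 0"
    and count: "\<And>n. n \<ge> 3 \<Longrightarrow> \<exists>M::nat. real M ^ DIM('a) * (\<tau> / sqrt (real n) * exp (c * (real M)\<^sup>2)) \<le> 1 / 2 \<and>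
      (b * ln (real n)) powr (real DIM('a) / 2) \<le> real M ^ DIM('a)"
    by blast
  let ?N = "(fourier_inf \<eta>)\<^sup>2 * \<nu> ^ DIM('a)"
  \<comment> \<open>The constant may depend on \<open>\<eta>\<close> and \<open>\<nu>\<close>, so the factor \<open>?N\<close> is divided out.\<close>
  define C' where "C' = A * \<tau>\<^sup>2 * b powr (real DIM('a) / 2) / ?N"
  have N: "?N > 0" using assms(1,4) by simp
  have "C' > 0" using A \<tau> b N by (simp add: C'_def)
  moreover have "ennreal (C' * (?N * (ln (real n) powr (real DIM('a) / 2) / real n))) \<le> minimax_risk n (mixtures \<phi> \<nu>)"
    if n: "n \<ge> 3" for n :: nat
  proof -
    obtain M :: nat where M: "real M ^ DIM('a) * (\<tau> / sqrt (real n) * exp (c * (real M)\<^sup>2)) \<le> 1 / 2"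
      "(b * ln (real n)) powr (real DIM('a) / 2) \<le> real M ^ DIM('a)"
      using count[OF n] by blast
    have sq: "(\<tau> / sqrt (real n))\<^sup>2 = \<tau>\<^sup>2 / real n" by (simp add: power_divide)
    have "\<tau>\<^sup>2 \<le> (1 / 2)\<^sup>2" using \<tau> by (intro power_mono) auto
    then have "real n * (2 * (\<tau> / sqrt (real n)))\<^sup>2 \<le> 1"
      using n unfolding power_mult_distrib sq by (simp add: power2_eq_square)
    then have "ennreal (A * (\<tau>\<^sup>2 / real n) * real M ^ DIM('a)) \<le> minimax_risk n (mixtures \<phi> \<nu>)"
      using modes[of "\<tau> / sqrt (real n)" M n] M(1) \<tau> unfolding sq by simp
    moreover have "C' * (?N * (ln (real n) powr (real DIM('a) / 2) / real n)) \<le> A * (\<tau>\<^sup>2 / real n) * real M ^ DIM('a)"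
    proof -
      have "C' * (?N * (ln (real n) powr (real DIM('a) / 2) / real n))
          = A * \<tau>\<^sup>2 * b powr (real DIM('a) / 2) * (ln (real n) powr (real DIM('a) / 2) / real n)"
        using assms(1,4) by (simp add: C'_def)
      also have "\<dots> = A * (\<tau>\<^sup>2 / real n) * (b * ln (real n)) powr (real DIM('a) / 2)"
        using b n by (simp add: powr_mult)
      also have "\<dots> \<le> A * (\<tau>\<^sup>2 / real n) * real M ^ DIM('a)"
        using M(2) A by (intro mult_left_mono) auto
      finally show ?thesis .
    qed
    ultimately show ?thesis by (meson ennreal_leI order_trans)
  qed
  ultimately show "\<exists>C'>0. \<forall>n\<ge>3. minimax_risk n (mixtures \<phi> \<nu>) \<ge>
            ennreal (C' * ((fourier_inf \<eta>)\<^sup>2 * \<nu> ^ DIM('a) *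
              (ln (real n) powr (real DIM('a) / 2) / real n)))"
    by blast
  show "\<phi> \<in> L2 \<inter> Linf \<inter> prob_densities"
    unfolding assms(3) by (rule gauss_conv_regular(1)[OF assms(2)])
  show "\<exists>c>0. \<exists>C>0. \<forall>\<xi>. cmod (fourier (\<lambda>x. complex_of_real (\<phi> x)) \<xi>) \<le> C * exp (- c * (norm \<xi>)\<^sup>2)"
    unfolding assms(3) using gauss_conv_regular(2)[OF assms(2)]
    by (intro exI[of _ "1 / 2"] exI[of _ "(2 * pi) powr (- (real DIM('a) / 2))"] conjI allI) auto
qed

end
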